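(* Let $(\gamma_k)_{k\ge1}$ be a fixed sequence of real numbers with $\gamma_k>-1$. For each $n\ge1$ let the vector of random moments $\mathbf{m}_n\in\mathcal{M}_n([0,\infty))$ be governed by the law with density $$g_n^{(\gamma,\delta)}(\mathbf{m}_n)=\prod_{k=1}^n\frac{\delta_k^{\gamma_k+n-k+1}}{\Gamma(\gamma_k+n-k+1)}\;\prod_{k=1}^nz_k(\mathbf{m}_n)^{\gamma_k}\exp\big(-\delta_kz_k(\mathbf{m}_n)\big)\mathbf{1}_{\{z_k(\mathbf{m}_n)>0\}},\qquad \delta_1=\dots=\delta_n=n .$$ Let $k\ge1$ be fixed and for $n\ge k$ let $\mathbf{m}_k^{(n)}$ be the projection of $\mathbf{m}_n$ onto its first $k$ coordinates. Then $$\sqrt n\,C^{-1}\big(\mathbf{m}_k^{(n)}-\mathbf{m}_k(\eta)\big)\longrightarrow\mathcal{N}_k(0,I_k)$$ in distribution as $n\to\infty$, where $\mathbf{m}_k(\eta)=(c_1,\dots,c_k)^T$, with $c_j=\frac{1}{j+1}\binom{2j}{j}$, contains the first $k$ moments of the Marchenko--Pastur distribution $\eta$, and $C=(c_{i,j})$ is the $k\times k$ lower triangular matrix with entries $c_{1,1}=\dots=c_{k,k}=1$ and $$c_{i,j}=\binom{2i}{i-j}-\binom{2i}{i-j-1},\qquad j<i .$$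
   Context: $\mathcal{P}([0,\infty))$ is the set of probability measures on $[0,\infty)$ with all moments existing, $m_k(\mu)=\int x^k\,\mu(dx)$, and $\mathcal{M}_n([0,\infty))=\{(m_1(\mu),\dots,m_n(\mu))^T:\mu\in\mathcal{P}([0,\infty))\}\subset\mathbb{R}^n$. Densities are with respect to Lebesgue measure and vanish outside the interior of the moment space. For $(m_1,\dots,m_{k-1})$ in the interior of $\mathcal{M}_{k-1}([0,\infty))$, $m_k^-$ is the minimum of $m_k(\mu)$ over all $\mu\in\mathcal{P}([0,\infty))$ with $m_i(\mu)=m_i$ for $i=1,\dots,k-1$; a point $\mathbf{m}_n=(m_1,\dots,m_n)^T$ is in the interior of $\mathcal{M}_n([0,\infty))$ iff $m_k>m_k^-$ for all $k=1,\dots,n$. For such a point $$z_k(\mathbf{m}_n)=\frac{m_k-m_k^-}{m_{k-1}-m_{k-1}^-},\qquad k=1,\dots,n,\qquad m_0=1,\ m_0^-=0 .$$ The Marchenko--Pastur distribution is $d\eta(x)=\frac{\sqrt{x(4-x)}}{2\pi x}\mathbf{1}_{\{0<x<4\}}\,dx$; its $j$th moment is the Catalan number $c_j=\frac1{j+1}\binom{2j}{j}$. $\mathcal{N}_k(0,I_k)$ is the standard normal distribution on $\mathbb{R}^k$. *)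

theory Defs
  imports "HOL-Probability.Probability"
begin

(* A vector (v_1, ..., v_n) in R^n is an element of the extensional function space
   PiE {1..n} (%_. UNIV) :: (nat => real) set, so that n may vary inside a statement.
   Its topology is the product topology, its Borel sets and Lebesgue measure are those of
   the product measures over {1..n}. *)

abbreviation Rn_topology :: "nat \<Rightarrow> (nat \<Rightarrow> real) topology" where
  "Rn_topology n \<equiv> product_topology (\<lambda>_. euclideanreal) {1..n}"

abbreviation Rn_borel :: "nat \<Rightarrow> (nat \<Rightarrow> real) measure" where
  "Rn_borel n \<equiv> Pi\<^sub>M {1..n} (\<lambda>_. borel)"

abbreviation Rn_lebesgue :: "nat \<Rightarrow> (nat \<Rightarrow> real) measure" where
  "Rn_lebesgue n \<equiv> Pi\<^sub>M {1..n} (\<lambda>_. lborel)"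

definition weak_convergence ::
    "'a topology \<Rightarrow> (nat \<Rightarrow> 'a measure) \<Rightarrow> 'a measure \<Rightarrow> bool" where
  "weak_convergence T M N \<longleftrightarrow>
     (\<forall>f. continuous_map T euclideanreal f \<and> bounded (f ` topspace T) \<longrightarrow>
        (\<lambda>n. \<integral>x. f x \<partial>M n) \<longlonglongrightarrow> (\<integral>x. f x \<partial>N))"

definition moment :: "real measure \<Rightarrow> nat \<Rightarrow> real" where
  "moment \<mu> k = (\<integral>x. x ^ k \<partial>\<mu>)"

definition halfline_measures :: "real measure set" where
  "halfline_measures =
     {\<mu>. real_distribution \<mu> \<and> (AE x in \<mu>. 0 \<le> x) \<and> (\<forall>k. integrable \<mu> (\<lambda>x. x ^ k))}"

definition moment_space :: "nat \<Rightarrow> (nat \<Rightarrow> real) set" where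
  "moment_space n = (\<lambda>\<mu>. \<lambda>i\<in>{1..n}. moment \<mu> i) ` halfline_measures"

(* m_k^-, a function of m_1, ..., m_{k-1}.  LEAST is the minimum of the set of admissible
   values; it exists whenever (m_1, ..., m_{k-1}) is interior to the moment space, the only
   case in which the value is used. *)
definition lower_moment :: "(nat \<Rightarrow> real) \<Rightarrow> nat \<Rightarrow> real" where
  "lower_moment m k =
     (if k = 0 then 0
      else LEAST x. x \<in> {moment \<mu> k | \<mu>. \<mu> \<in> halfline_measures \<and> (\<forall>i\<in>{1..<k}. moment \<mu> i = m i)})"

(* Vectors are indexed from 1, so the convention m_0 = 1 has to be supplied. *)
definition moment_gap :: "(nat \<Rightarrow> real) \<Rightarrow> nat \<Rightarrow> real" where
  "moment_gap m k = (if k = 0 then 1 else m k) - lower_moment m k"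

definition z_coord :: "(nat \<Rightarrow> real) \<Rightarrow> nat \<Rightarrow> real" where
  "z_coord m k = moment_gap m k / moment_gap m (k - 1)"

(* Densities vanish outside the interior of the moment space. *)
definition moment_density ::
    "(nat \<Rightarrow> real) \<Rightarrow> (nat \<Rightarrow> real) \<Rightarrow> nat \<Rightarrow> (nat \<Rightarrow> real) \<Rightarrow> real" where
  "moment_density \<gamma> \<delta> n m =
     (\<Prod>k=1..n. \<delta> k powr (\<gamma> k + real n - real k + 1) / Gamma (\<gamma> k + real n - real k + 1)) *
     (\<Prod>k=1..n. z_coord m k powr \<gamma> k * exp (- \<delta> k * z_coord m k) *
                indicator {0<..} (z_coord m k)) *
     indicator (Rn_topology n interior_of moment_space n) m"

definition marchenko_pastur :: "real measure" where
  "marchenko_pastur =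
     density lborel (\<lambda>x. ennreal (sqrt (x * (4 - x)) / (2 * pi * x) * indicator {0<..<4} x))"

definition catalan :: "nat \<Rightarrow> real" where
  "catalan j = 1 / real (j + 1) * real ((2 * j) choose j)"

definition C_matrix :: "nat \<Rightarrow> nat \<Rightarrow> real" where
  "C_matrix i j =
     (if i = j then 1
      else if j < i then real ((2 * i) choose (i - j)) - real ((2 * i) choose (i - j - 1))
      else 0)"

(* The k x k counterpart of matrix_inv, with indices running over {1..k}. *)
definition matrix_inverse :: "nat \<Rightarrow> (nat \<Rightarrow> nat \<Rightarrow> real) \<Rightarrow> (nat \<Rightarrow> nat \<Rightarrow> real)" where
  "matrix_inverse k A =
     (SOME B. \<forall>i\<in>{1..k}. \<forall>j\<in>{1..k}.
        (\<Sum>l=1..k. A i l * B l j) = (if i = j then 1 else 0) \<and>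
        (\<Sum>l=1..k. B i l * A l j) = (if i = j then 1 else 0))"

definition mat_vec :: "nat \<Rightarrow> (nat \<Rightarrow> nat \<Rightarrow> real) \<Rightarrow> (nat \<Rightarrow> real) \<Rightarrow> (nat \<Rightarrow> real)" where
  "mat_vec k A v = (\<lambda>i\<in>{1..k}. \<Sum>j=1..k. A i j * v j)"

(* N_k(0, I_k) as the law of k independent standard normal variables. *)
definition std_normal_Rn :: "nat \<Rightarrow> (nat \<Rightarrow> real) measure" where
  "std_normal_Rn k = Pi\<^sub>M {1..k} (\<lambda>_. density lborel (\<lambda>x. ennreal (std_normal_density x)))"

end

theory Submission
  imports Defs
    "Jordan_Normal_Form.Determinant"
    "HOL-Computational_Algebra.Fundamental_Theorem_Algebra"
    "HOL-Real_Asymp.Real_Asymp"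
begin

text \<open>A vector of moments is encoded by the coordinates \<open>z\<^sub>1, z\<^sub>2, \<dots>\<close> of its Stieltjes continued
fraction: the \<open>j\<close>-th moment is the total weight of the Dyck paths of length \<open>2 j\<close>, where a
down-step from height \<open>i\<close> weighs \<open>z\<^sub>i\<close> (\<open>dyck_moment\<close>).  Only one such path reaches height \<open>j\<close>, so
\<open>m\<^sub>j\<close> equals \<open>z\<^sub>1 \<cdots> z\<^sub>j\<close> plus the value of \<open>m\<^sub>j\<close> at \<open>z\<^sub>j = 0\<close>, and the latter involves only the
earlier coordinates (\<open>dyck_moment_peak\<close>).  The point of the encoding is that this latter value is
the minimum \<open>m\<^sub>j\<^sup>-\<close>: it is attained by a Gauss quadrature measure located at the squared zeros of an
orthogonal polynomial (\<open>minimal_measure_exists\<close>), and it is a lower bound because the square of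
that polynomial has a nonnegative integral (\<open>moment_lower_bound\<close>).  Hence the \<open>z\<^sub>k\<close> of the density
are exactly these weights (\<open>z_coord_dyck\<close>).

The map from coordinates to moments is triangular with Jacobian \<open>\<Prod> z\<^sub>j ^ (n - j)\<close>, which turns
the density of the moments into a product of gamma densities of shape \<open>\<gamma>\<^sub>j + n - j + 1\<close> and rate
\<open>\<delta>\<^sub>j\<close>.  The image of the positive orthant is open and consists of moment vectors, so it lies in the
interior of the moment space, and the transported density already has total mass one there.
Therefore the random moments have the law of the Dyck moments of independent gamma variables
(\<open>random_moments_law\<close>).

With rate \<open>n\<close>, each coordinate is \<open>1 + x / sqrt n\<close> with \<open>x\<close> asymptotically standard normal.  At
\<open>z = 1\<close> the Dyck moments are the Catalan numbers, and their partial derivatives count Dyck paths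
with a marked down-step, which gives the entries of the matrix \<open>C\<close>
(\<open>dyck_moment_has_derivative\<close>).  So the rescaled moments, as a function of the standardised
coordinates \<open>x\<close>, converge pointwise to \<open>C\<^sup>-\<^sup>1 C x = x\<close> (\<open>rescaled_moments_limit\<close>).  A single dominated
convergence argument handles this together with the convergence of the densities
(\<open>gamma_product_clt\<close>); normalising constants cancel because the same argument applies to the
constant function 1.\<close>

section \<open>Weighted Dyck paths and ballot numbers\<close>

text \<open>The total weight of the lattice paths with \<open>n\<close> steps \<open>\<plusminus>1\<close> from height 0 to height \<open>h\<close> that never go
below 0, where a down-step from height \<open>i\<close> to height \<open>i - 1\<close> has weight \<open>z i\<close> and up-steps have
weight 1.  The recursion removes the last step.\<close>

primrec path_weight :: "(nat \<Rightarrow> real) \<Rightarrow> nat \<Rightarrow> nat \<Rightarrow> real" where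
  "path_weight z 0 h = (if h = 0 then 1 else 0)"
| "path_weight z (Suc n) h =
     (if h = 0 then 0 else path_weight z n (h - 1)) + z (Suc h) * path_weight z n (Suc h)"

definition dyck_moment :: "(nat \<Rightarrow> real) \<Rightarrow> nat \<Rightarrow> real" where
  "dyck_moment z j = path_weight z (2 * j) 0"

lemma path_weight_above: "n < h \<Longrightarrow> path_weight z n h = 0"
  by (induction n arbitrary: h) auto

lemma path_weight_diagonal: "path_weight z n n = 1"
  by (induction n) (auto simp: path_weight_above)

text \<open>A path that visits height \<open>i\<close> and ends at height \<open>h\<close> after \<open>n\<close> steps satisfies \<open>2 i \<le> n + h\<close>, so
no other weights matter.\<close>

lemma path_weight_cong:
  assumes "\<And>i. 1 \<le> i \<Longrightarrow> 2 * i \<le> n + h \<Longrightarrow> z i = z' i"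
  shows "path_weight z n h = path_weight z' n h"
  using assms
proof (induction n arbitrary: h)
  case (Suc n)
  have 1: "path_weight z n (h - 1) = path_weight z' n (h - 1)" if "h \<noteq> 0"
    using that by (intro Suc.IH Suc.prems) auto
  have 2: "path_weight z n (Suc h) = path_weight z' n (Suc h)"
    by (intro Suc.IH Suc.prems) auto
  have 3: "z (Suc h) * path_weight z' n (Suc h) = z' (Suc h) * path_weight z' n (Suc h)"
  proof (cases "Suc h \<le> n")
    case True
    then show ?thesis using Suc.prems[of "Suc h"] by simp
  qed (simp add: path_weight_above)
  show ?case
    unfolding path_weight.simps 2 3 using 1 by simp
qed simp

lemma dyck_moment_cong:
  assumes "\<And>i. 1 \<le> i \<Longrightarrow> i \<le> j \<Longrightarrow> z i = z' i"
  shows "dyck_moment z j = dyck_moment z' j"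
  unfolding dyck_moment_def by (rule path_weight_cong) (use assms in auto)

lemma dyck_moment_0 [simp]: "dyck_moment z 0 = 1"
  by (simp add: dyck_moment_def)

text \<open>Among the paths from 0 to \<open>h < j\<close> with \<open>2 j - h\<close> steps, all but one stay strictly below height
\<open>j\<close>; the exception climbs straight to \<open>j\<close> and then descends, with weight \<open>z\<^sub>j \<cdots> z\<^bsub>h+1\<^esub>\<close>.
Setting \<open>z\<^sub>j = 0\<close> removes exactly this path.\<close>

lemma path_weight_peak:
  assumes "n + h = 2 * j" "h < j"
  shows "path_weight z n h = path_weight (z(j := 0)) n h + (\<Prod>i=Suc h..j. z i)"
  using assms
proof (induction n arbitrary: h)
  case (Suc n)
  have down: "path_weight z n (h - 1) = path_weight (z(j := 0)) n (h - 1)" if "h \<noteq> 0"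
    using that Suc.prems by (intro path_weight_cong) auto
  show ?case
  proof (cases "Suc h = j")
    case True
    then have "n = Suc h" using Suc.prems by simp
    then have "path_weight z n (Suc h) = 1" by (simp only: path_weight_diagonal)
    then show ?thesis
      unfolding path_weight.simps using True down by (simp del: fun_upd_apply add: fun_upd_same)
  next
    case False
    then have "path_weight z n (Suc h)
        = path_weight (z(j := 0)) n (Suc h) + (\<Prod>i=Suc (Suc h)..j. z i)"
      using Suc.prems by (intro Suc.IH) auto
    moreover have "(\<Prod>i=Suc h..j. z i) = z (Suc h) * (\<Prod>i=Suc (Suc h)..j. z i)"
      using Suc.prems by (intro prod.atLeast_Suc_atMost) simp
    ultimately show ?thesis
      unfolding path_weight.simps using False down
      by (simp add: algebra_simps fun_upd_other del: fun_upd_apply)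
  qed
qed simp

lemma dyck_moment_peak:
  assumes "1 \<le> j"
  shows "dyck_moment z j = dyck_moment (z(j := 0)) j + (\<Prod>i=1..j. z i)"
  using path_weight_peak[of "2 * j" 0 j z] assms by (simp add: dyck_moment_def)

text \<open>With unit weights the paths are merely counted.\<close>

abbreviation ballot :: "nat \<Rightarrow> nat \<Rightarrow> real" where
  "ballot \<equiv> path_weight (\<lambda>_. 1)"

text \<open>The classical ballot numbers for \<open>u\<close> up-steps and \<open>d\<close> down-steps.  The case distinction in the
subtracted term replaces a binomial coefficient with lower index \<open>- 1\<close>.\<close>

lemma ballot_closed_form:
  assumes "d \<le> u"
  shows "ballot (u + d) (u - d) =
    real ((u + d) choose d) - (if d = 0 then 0 else real ((u + d) choose (d - 1)))"
  using assms
proof (induction "u + d" arbitrary: u d)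
  case (Suc n)
  show ?case
  proof (cases d)
    case 0
    then show ?thesis by (simp add: path_weight_diagonal)
  next
    case d: (Suc d')
    then have n: "n = u + d'" using Suc.hyps(2) by simp
    have up: "ballot n (Suc (u - d)) = real (n choose d')
        - (if d' = 0 then 0 else real (n choose (d' - 1)))"
      using Suc.hyps(1)[of u d'] n d Suc.prems by (simp add: Suc_diff_Suc)
    have step: "ballot (u + d) (u - d) =
        (if u = d then 0 else ballot n (u - d - 1)) + ballot n (Suc (u - d))"
      using Suc.prems by (simp flip: Suc.hyps(2))
    have pascal: "real ((u + d) choose d) = real (n choose d') + real (n choose d)"
      using d n by (simp flip: Suc.hyps(2))
    have pascal': "real ((u + d) choose d') = (if d' = 0 then 1
        else real (n choose (d' - 1)) + real (n choose d'))"
      by (cases d') (auto simp flip: Suc.hyps(2))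
    have down: "(if u = d then 0 else ballot n (u - d - 1)) =
        real (n choose d) - real (n choose d')"
    proof (cases "u = d")
      case True
      then show ?thesis using binomial_symmetric[of d' n] n d by simp
    next
      case False
      then show ?thesis
        using Suc.hyps(1)[of "u - 1" d] n d Suc.prems by simp
    qed
    show ?thesis
      unfolding step down up pascal using d pascal' by simp
  qed
qed simp

lemma ballot_catalan:
  assumes "1 \<le> i"
  shows "ballot (2 * i) 0 = catalan i"
proof -
  obtain k where k: "i = Suc k" using assms by (cases i) auto
  have "Suc k * (2 * i choose Suc k) = (2 * i - k) * (2 * i choose k)"
    by (simp only: binomial_absorb_comp binomial_absorption)
  moreover have "2 * i - k = i + 1" "i - 1 = k" using k by auto
  ultimately have "i * (2 * i choose i) = (i + 1) * (2 * i choose (i - 1))"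
    using k by simp
  then have "real i * real (2 * i choose i) = (real i + 1) * real (2 * i choose (i - 1))"
    by (metis of_nat_1 of_nat_add of_nat_mult)
  moreover have "ballot (2 * i) 0 = real (2 * i choose i) - real (2 * i choose (i - 1))"
    using ballot_closed_form[of i i] assms by (simp flip: mult_2)
  ultimately have "(real i + 1) * ballot (2 * i) 0 = real (2 * i choose i)"
    by (simp only: right_diff_distrib) (simp add: distrib_right)
  then show ?thesis
    by (simp add: catalan_def field_simps)
qed

lemma ballot_C_matrix:
  assumes "1 \<le> j" "j \<le> i"
  shows "ballot (2 * i) (2 * j) = C_matrix i j"
proof -
  have eq: "i + j + (i - j) = 2 * i" "i + j - (i - j) = 2 * j" using assms by auto
  have "ballot (2 * i) (2 * j) = real (2 * i choose (i - j))
      - (if i - j = 0 then 0 else real (2 * i choose (i - j - 1)))"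
    using ballot_closed_form[of "i - j" "i + j"] assms unfolding eq by simp
  then show ?thesis
    using assms by (cases "i = j") (auto simp: C_matrix_def)
qed

text \<open>The number of paths from 0 to \<open>h\<close> with a marked down-step from height \<open>j\<close>.  Cutting such a path
at the mark leaves a path from 0 to \<open>j\<close> and a path from \<open>j - 1\<close> to \<open>h\<close>; if \<open>r\<close> is the lowest
height of the second part, the generating functions show that the marked paths with given \<open>r\<close>
are as many as the paths from 0 to \<open>2 j + h - 2 r\<close>.  The formula is taken as the definition, since
it satisfies the recursion of the marked count.\<close>

definition marked_ballot :: "nat \<Rightarrow> nat \<Rightarrow> nat \<Rightarrow> real" where
  "marked_ballot j n h = (\<Sum>r\<le>min (j - 1) h. ballot n (2 * j + h - 2 * r))"

lemma marked_ballot_0: "1 \<le> j \<Longrightarrow> marked_ballot j 0 h = 0"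
  unfolding marked_ballot_def by (intro sum.neutral) auto

text \<open>The last step is an unmarked up-step, an unmarked down-step, or the marked step itself, which is
possible only for \<open>h = j - 1\<close>.  In terms of the defining sums the three cases differ only in
whether the summand \<open>r = h\<close> or \<open>r = h + 1\<close> falls within the range.\<close>

lemma marked_ballot_Suc:
  assumes "1 \<le> j"
  shows "marked_ballot j (Suc n) h =
    (if h = 0 then 0 else marked_ballot j n (h - 1)) + marked_ballot j n (Suc h)
      + (if Suc h = j then ballot n j else 0)"
proof -
  let ?m = "min (j - 1) h"
  have "marked_ballot j (Suc n) h =
      (\<Sum>r\<le>?m. ballot n (2 * j + h - 2 * r - 1)) + (\<Sum>r\<le>?m. ballot n (2 * j + h - 2 * r + 1))"
    unfolding marked_ballot_def sum.distrib[symmetric]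
    using assms by (intro sum.cong refl) (auto simp: path_weight_above)
  moreover have "(\<Sum>r\<le>?m. ballot n (2 * j + h - 2 * r - 1)) =
      (if h = 0 then 0 else marked_ballot j n (h - 1))
        + (if h < j then ballot n (2 * j - h - 1) else 0)"
  proof (cases "h < j")
    case True
    then have "?m = h" by simp
    then show ?thesis
      using True unfolding marked_ballot_def
      by (cases h) (auto intro!: sum.cong arg_cong[where f = "ballot n"] simp: min_def)
  next
    case False
    then show ?thesis
      unfolding marked_ballot_def using assms
      by (auto intro!: sum.cong arg_cong[where f = "ballot n"] simp: min_def)
  qed
  moreover have "marked_ballot j n (Suc h) =
      (\<Sum>r\<le>?m. ballot n (2 * j + h - 2 * r + 1))
        + (if Suc h < j then ballot n (2 * j - h - 1) else 0)"
  proof (cases "Suc h < j")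
    case True
    then have m: "min (j - 1) (Suc h) = Suc h" "?m = h" by auto
    have "2 * j + Suc h - 2 * Suc h = 2 * j - h - 1" using True by simp
    then show ?thesis
      using True unfolding marked_ballot_def m
      by (auto intro!: sum.cong arg_cong[where f = "ballot n"])
  next
    case False
    then have m: "min (j - 1) (Suc h) = ?m" using assms by simp
    show ?thesis
      using False unfolding marked_ballot_def m
      by (auto intro!: sum.cong arg_cong[where f = "ballot n"])
  qed
  moreover have "2 * j - h - 1 = j" if "Suc h = j" using that by auto
  ultimately show ?thesis by auto
qed

text \<open>Differentiating a product of weights selects one down-step, from height \<open>j\<close> say, and replaces its
weight by \<open>x\<^sub>j\<close>.\<close>

lemma path_weight_has_derivative:
  "((\<lambda>e. path_weight (\<lambda>i. 1 + e * x i) n h) has_real_derivative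
     (\<Sum>j=1..N. x j * marked_ballot j n h)) (at 0)"
  if "n \<le> N"
  using that
proof (induction n arbitrary: h)
  case 0
  then show ?case by (simp add: marked_ballot_0)
next
  case (Suc n)
  let ?D = "\<lambda>h. \<Sum>j=1..N. x j * marked_ballot j n h"
  have IH: "((\<lambda>e. path_weight (\<lambda>i. 1 + e * x i) n h) has_real_derivative ?D h) (at 0)" for h
    using Suc by simp
  \<comment> \<open>If \<open>Suc h > N\<close>, all terms of the sum vanish, and so does the right-hand side because \<open>n\<close>
    steps do not reach height \<open>Suc h\<close>.\<close>
  have mark: "(\<Sum>j=1..N. x j * (if Suc h = j then ballot n j else 0)) = x (Suc h) * ballot n (Suc h)"
  proof (cases "Suc h \<le> N")
    case True
    have "(\<Sum>j=1..N. x j * (if Suc h = j then ballot n j else 0)) =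
        (\<Sum>j=1..N. if Suc h = j then x (Suc h) * ballot n (Suc h) else 0)"
      by (intro sum.cong) auto
    then show ?thesis using True by simp
  next
    case False
    then show ?thesis using Suc.prems by (auto simp: path_weight_above intro!: sum.neutral)
  qed
  have D: "(\<Sum>j=1..N. x j * marked_ballot j (Suc n) h) =
      (if h = 0 then 0 else ?D (h - 1)) + (?D (Suc h) + x (Suc h) * ballot n (Suc h))"
    unfolding mark[symmetric] sum.distrib[symmetric]
    by (auto simp: marked_ballot_Suc algebra_simps sum.distrib[symmetric] intro!: sum.cong)
  have "((\<lambda>e. (1 + e * x (Suc h)) * path_weight (\<lambda>i. 1 + e * x i) n (Suc h)) has_real_derivative
      (?D (Suc h) + x (Suc h) * ballot n (Suc h))) (at 0)"
    by (auto intro!: derivative_eq_intros IH[of "Suc h"])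
  moreover have "((\<lambda>e. if h = 0 then 0 else path_weight (\<lambda>i. 1 + e * x i) n (h - 1))
      has_real_derivative (if h = 0 then 0 else ?D (h - 1))) (at 0)"
    using IH[of "h - 1"] by (cases "h = 0") auto
  ultimately show ?case
    unfolding D path_weight.simps by (rule DERIV_add[rotated])
qed

text \<open>The rows of the matrix \<open>C\<close> are the gradients of the Dyck moments at the point \<open>z = 1\<close>.\<close>

lemma dyck_moment_has_derivative:
  assumes "1 \<le> i" "i \<le> k"
  shows "((\<lambda>e. dyck_moment (\<lambda>l. 1 + e * x l) i) has_real_derivative
     (\<Sum>j=1..k. C_matrix i j * x j)) (at 0)"
proof -
  have eq: "(\<Sum>j=1..2*k. x j * marked_ballot j (2 * i) 0) = (\<Sum>j=1..k. C_matrix i j * x j)"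
  proof (rule sum.mono_neutral_cong_right)
    show "\<forall>j\<in>{1..2 * k} - {1..k}. x j * marked_ballot j (2 * i) 0 = 0"
      using assms by (auto simp: marked_ballot_def path_weight_above)
    show "x j * marked_ballot j (2 * i) 0 = C_matrix i j * x j" if "j \<in> {1..k}" for j
    proof (cases "j \<le> i")
      case True
      then show ?thesis using that by (simp add: marked_ballot_def ballot_C_matrix)
    next
      case False
      then show ?thesis using that
        by (simp add: marked_ballot_def path_weight_above C_matrix_def)
    qed
  qed auto
  show ?thesis
    unfolding dyck_moment_def eq[symmetric]
    by (rule path_weight_has_derivative) (use assms in simp)
qed

lemma dyck_moment_at_1: "1 \<le> i \<Longrightarrow> dyck_moment (\<lambda>_. 1) i = catalan i"
  by (simp add: dyck_moment_def ballot_catalan)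

section \<open>Orthogonal polynomials and Gauss quadrature\<close>

text \<open>The monic orthogonal polynomials of the symmetric measure whose even moments are the Dyck moments
of \<open>z\<close>, given by their three-term recurrence.  Working with the symmetrised measure treats even and
odd moments on the half-line uniformly.  They are defined over a general field because the proof
that the zeros are real passes through the complex numbers.\<close>

fun orth_poly :: "(nat \<Rightarrow> real) \<Rightarrow> nat \<Rightarrow> 'a::{real_normed_field} poly" where
  "orth_poly z 0 = 1"
| "orth_poly z (Suc 0) = [:0, 1:]"
| "orth_poly z (Suc (Suc k)) =
     [:0, 1:] * orth_poly z (Suc k) - Polynomial.smult (of_real (z (Suc k))) (orth_poly z k)"

text \<open>The Christoffel--Darboux kernel, multiplied by \<open>z\<^sub>1 \<cdots> z\<^sub>k\<close> so that no divisions occur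
(see \<open>CD_kernel_sum\<close>).\<close>

fun CD_kernel :: "(nat \<Rightarrow> real) \<Rightarrow> nat \<Rightarrow> 'a::real_normed_field \<Rightarrow> 'a \<Rightarrow> 'a" where
  "CD_kernel z 0 x y = 1"
| "CD_kernel z (Suc k) x y =
     poly (orth_poly z (Suc k)) x * poly (orth_poly z (Suc k)) y + of_real (z (Suc k)) * CD_kernel z k x y"

lemma Christoffel_Darboux:
  "(x - y) * CD_kernel z k x y =
     poly (orth_poly z (Suc k)) x * poly (orth_poly z k) y -
     poly (orth_poly z k) x * poly (orth_poly z (Suc k)) y"
proof (induction k)
  case (Suc k)
  have "(x - y) * CD_kernel z (Suc k) x y =
      (x - y) * (poly (orth_poly z (Suc k)) x * poly (orth_poly z (Suc k)) y)
      + of_real (z (Suc k)) * ((x - y) * CD_kernel z k x y)"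
    by (simp add: algebra_simps)
  then show ?case unfolding Suc.IH by (simp add: algebra_simps)
qed simp

lemma Christoffel_Darboux_confluent:
  "CD_kernel z k x x =
     poly (pderiv (orth_poly z (Suc k))) x * poly (orth_poly z k) x -
     poly (pderiv (orth_poly z k)) x * poly (orth_poly z (Suc k)) x"
proof (induction k)
  case (Suc k)
  show ?case
    unfolding CD_kernel.simps Suc.IH
    by (simp add: algebra_simps pderiv_diff pderiv_smult pderiv_pCons)
qed (simp add: pderiv_pCons)

lemma CD_kernel_sum:
  assumes "\<And>i. 1 \<le> i \<Longrightarrow> i \<le> k \<Longrightarrow> z i > 0"
  shows "CD_kernel z k x y = of_real (\<Prod>i=1..k. z i) *
    (\<Sum>j\<le>k. poly (orth_poly z j) x * poly (orth_poly z j) y / of_real (\<Prod>i=1..j. z i))"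
  using assms
proof (induction k)
  case (Suc k)
  have "(\<Prod>i=1..Suc k. z i) > 0" using Suc.prems by (intro prod_pos) auto
  then have "of_real (\<Prod>i=1..Suc k. z i) \<noteq> (0::'a)"
    using of_real_eq_0_iff by (metis less_irrefl)
  then have nz: "of_real (z (Suc k)) \<noteq> (0::'a)" "of_real (\<Prod>i=1..k. z i) \<noteq> (0::'a)"
    by auto
  show ?case
    using Suc.IH Suc.prems nz by (simp add: field_simps)
qed simp

lemma poly_orth_poly_of_real:
  "poly (orth_poly z k) (of_real x :: 'a::real_normed_field) = of_real (poly (orth_poly z k) x)"
  by (induction z k rule: orth_poly.induct) auto

lemma poly_orth_poly_cnj: "poly (orth_poly z k) (cnj x) = cnj (poly (orth_poly z k) x)"
  by (induction z k rule: orth_poly.induct) auto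

lemma coeff_orth_poly_above: "k < i \<Longrightarrow> coeff (orth_poly z k) i = 0"
  by (induction z k arbitrary: i rule: orth_poly.induct) (auto simp: coeff_pCons split: nat.split)

lemma coeff_orth_poly_top: "coeff (orth_poly z k) k = 1"
  by (induction z k rule: orth_poly.induct) (auto simp: coeff_pCons coeff_orth_poly_above split: nat.split)

lemma degree_orth_poly: "degree (orth_poly z k) = k"
  by (intro antisym degree_le le_degree) (simp_all add: coeff_orth_poly_above coeff_orth_poly_top)

lemma poly_orth_poly_minus: "poly (orth_poly z k) (- x) = (- 1) ^ k * poly (orth_poly z k) x"
  by (induction z k rule: orth_poly.induct) (auto simp: algebra_simps)

text \<open>On the pairs \<open>(x, cnj x)\<close> the kernel is a sum of squared moduli with positive weights; the constant
polynomial contributes a positive term.\<close>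

lemma CD_kernel_cnj_pos:
  assumes "\<And>i. 1 \<le> i \<Longrightarrow> i \<le> k \<Longrightarrow> z i > 0"
  shows "\<exists>r>0. CD_kernel z k x (cnj x) = of_real r"
  using assms
proof (induction k)
  case 0
  show ?case by (rule exI[of _ 1]) simp
next
  case (Suc k)
  then obtain r where r: "r > 0" "CD_kernel z k x (cnj x) = of_real r" by auto
  have "CD_kernel z (Suc k) x (cnj x) =
      of_real ((cmod (poly (orth_poly z (Suc k)) x))\<^sup>2 + z (Suc k) * r)"
    by (simp add: r poly_orth_poly_cnj complex_norm_square[symmetric] del: orth_poly.simps)
  moreover have "(cmod (poly (orth_poly z (Suc k)) x))\<^sup>2 + z (Suc k) * r > 0"
    using r Suc.prems[of "Suc k"] by (intro add_nonneg_pos) auto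
  ultimately show ?case by blast
qed

text \<open>By the Christoffel--Darboux formula a non-real zero \<open>x\<close> would make the kernel vanish at
\<open>(x, cnj x)\<close>, and by its confluent form a multiple zero would make it vanish at \<open>(x, x)\<close>.  Both
contradict positivity, so all complex zeros are real and simple.\<close>

lemma orth_poly_real_roots:
  assumes "\<And>i. 1 \<le> i \<Longrightarrow> i \<le> k \<Longrightarrow> z i > 0"
  shows "card {x::real. poly (orth_poly z (Suc k)) x = 0} = Suc k"
proof -
  let ?p = "orth_poly z (Suc k) :: complex poly"
  have real: "x \<in> \<real>" if "poly ?p x = 0" for x
  proof -
    have "(x - cnj x) * CD_kernel z k x (cnj x) = 0"
      unfolding Christoffel_Darboux using that by (simp add: poly_orth_poly_cnj)
    then have "x = cnj x" using CD_kernel_cnj_pos[of k z x, OF assms] by auto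
    then show ?thesis by (simp add: complex_is_Real_iff complex_eq_iff)
  qed
  have simple: "poly (pderiv ?p) x \<noteq> 0" if x: "poly ?p x = 0" for x
  proof -
    obtain y where y: "x = of_real y" using real[OF x] by (auto elim: Reals_cases)
    have "CD_kernel z k x x \<noteq> 0"
      using CD_kernel_cnj_pos[of k z x, OF assms] y by auto
    then show ?thesis unfolding Christoffel_Darboux_confluent using x by auto
  qed
  have p: "degree ?p = Suc k" "lead_coeff ?p = 1" by (simp_all only: degree_orth_poly coeff_orth_poly_top)
  have "rsquarefree ?p" unfolding rsquarefree_roots using simple by blast
  then have "Polynomial.smult (lead_coeff ?p) (\<Prod>x | poly ?p x = 0. [:-x, 1:]) = ?p"
    by (rule complex_poly_decompose_rsquarefree)
  then have "degree (\<Prod>x | poly ?p x = 0. [:-x, 1:]) = Suc k" using p by simp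
  then have card: "card {x. poly ?p x = 0} = Suc k" by (subst (asm) degree_prod_sum_eq) auto
  have "{x. poly ?p x = 0} = of_real ` {x::real. poly (orth_poly z (Suc k)) x = 0}"
  proof (intro equalityI subsetI)
    fix x assume x: "x \<in> {x. poly ?p x = 0}"
    then obtain y where "x = of_real y" using real by (auto elim: Reals_cases)
    then show "x \<in> of_real ` {x::real. poly (orth_poly z (Suc k)) x = 0}"
      using x by (auto simp: poly_orth_poly_of_real simp del: orth_poly.simps)
  qed (auto simp: poly_orth_poly_of_real simp del: orth_poly.simps)
  then show ?thesis using card by (simp add: card_image inj_on_def)
qed

text \<open>For square matrices a right inverse is a left inverse.  This exchanges the orthogonality of the
eigenvectors of a finite Jacobi matrix, which is a sum over degrees, for the orthogonality of the
polynomials with respect to the quadrature weights, which is a sum over nodes.\<close>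

lemma square_right_inverse_is_left_inverse:
  fixes u v :: "nat \<Rightarrow> nat \<Rightarrow> real"
  assumes orth: "\<And>a b. a < n \<Longrightarrow> b < n \<Longrightarrow> (\<Sum>j<n. u a j * v j b) = (if a = b then 1 else 0)"
    and "i < n" "j < n"
  shows "(\<Sum>a<n. v i a * u a j) = (if i = j then 1 else 0)"
proof -
  define U where "U = mat n n (\<lambda>(a, j). u a j)"
  define V where "V = mat n n (\<lambda>(a, j). v a j)"
  have "U * V = 1\<^sub>m n"
    by (rule eq_matI) (auto simp: U_def V_def scalar_prod_def atLeast0LessThan orth)
  then have "V * U = 1\<^sub>m n"
    by (intro mat_mult_left_right_inverse[of U]) (auto simp: U_def V_def)
  then have "(V * U) $$ (i, j) = (1\<^sub>m n) $$ (i, j)" by simp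
  then show ?thesis
    using assms(2,3) by (simp add: U_def V_def scalar_prod_def atLeast0LessThan)
qed

text \<open>Multiplication by \<open>x\<close> acts on the orthogonal polynomials as one step of a lattice path.  At a zero of
the polynomial of degree \<open>k + 1\<close> this polynomial drops out, which amounts to forbidding the height
\<open>k + 1\<close>, that is, to setting \<open>z\<^bsub>k+1\<^esub> = 0\<close>; the resulting expansion is valid for all powers.\<close>

lemma power_at_orth_poly_root:
  fixes x :: real
  assumes "poly (orth_poly z (Suc k)) x = 0"
  shows "x ^ n = (\<Sum>h\<le>k. path_weight (z(Suc k := 0)) n h * poly (orth_poly z h) x)"
proof (induction n)
  case 0
  have "(\<Sum>h\<le>k. path_weight (z(Suc k := 0)) 0 h * poly (orth_poly z h) x) =
      (\<Sum>h\<le>k. if h = 0 then 1 else 0)"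
    by (intro sum.cong) auto
  then show ?case by simp
next
  case (Suc n)
  let ?w = "path_weight (z(Suc k := 0))" and ?S = "\<lambda>h. poly (orth_poly z h) x"
  have mult_x: "x * ?S h = ?S (Suc h) + (if h = 0 then 0 else z h * ?S (h - 1))" for h
    by (cases h) auto
  have up: "(\<Sum>h\<le>k. ?w n h * ?S (Suc h)) = (\<Sum>h\<le>k. (if h = 0 then 0 else ?w n (h - 1)) * ?S h)"
  proof -
    have "(\<Sum>h\<le>k. ?w n h * ?S (Suc h)) = (\<Sum>h<k. ?w n h * ?S (Suc h))"
      using assms by (simp add: lessThan_Suc_atMost[symmetric])
    also have "\<dots> = (\<Sum>h\<le>k. (if h = 0 then 0 else ?w n (h - 1)) * ?S h)"
      by (subst sum.atMost_shift) (simp del: orth_poly.simps)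
    finally show ?thesis .
  qed
  have down: "(\<Sum>h\<le>k. ?w n h * (if h = 0 then 0 else z h * ?S (h - 1))) =
      (\<Sum>h\<le>k. (z(Suc k := 0)) (Suc h) * ?w n (Suc h) * ?S h)"
  proof -
    have "(\<Sum>h\<le>k. ?w n h * (if h = 0 then 0 else z h * ?S (h - 1))) =
        (\<Sum>h<k. z (Suc h) * ?w n (Suc h) * ?S h)"
      by (subst sum.atMost_shift) (simp del: orth_poly.simps add: mult_ac)
    also have "\<dots> = (\<Sum>h\<le>k. (z(Suc k := 0)) (Suc h) * ?w n (Suc h) * ?S h)"
      by (simp add: lessThan_Suc_atMost[symmetric])
    finally show ?thesis .
  qed
  have "x ^ Suc n = (\<Sum>h\<le>k. ?w n h * (x * ?S h))"
    unfolding power_Suc Suc.IH sum_distrib_left by (intro sum.cong refl mult.left_commute)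
  also have "\<dots> = (\<Sum>h\<le>k. ?w n h * ?S (Suc h))
      + (\<Sum>h\<le>k. ?w n h * (if h = 0 then 0 else z h * ?S (h - 1)))"
    unfolding mult_x sum.distrib[symmetric] by (simp add: distrib_left)
  also have "\<dots> = (\<Sum>h\<le>k. ?w (Suc n) h * ?S h)"
    unfolding up down sum.distrib[symmetric] by (simp add: distrib_right)
  finally show ?case .
qed

text \<open>The weights are the Christoffel numbers \<open>1 / N x\<close>.  With them the polynomials of positive degree at
most \<open>k\<close> integrate to zero, so only the constant term of the expansion of \<open>x ^ n\<close> survives.\<close>

lemma Gauss_quadrature:
  fixes z :: "nat \<Rightarrow> real"
  assumes pos: "\<And>i. 1 \<le> i \<Longrightarrow> i \<le> k \<Longrightarrow> z i > 0"
  obtains A w where "finite (A::real set)" "\<And>x. x \<in> A \<Longrightarrow> poly (orth_poly z (Suc k)) x = 0"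
    "\<And>x. x \<in> A \<Longrightarrow> w x > 0"
    "\<And>n. (\<Sum>x\<in>A. w x * x ^ n) = path_weight (z(Suc k := 0)) n 0"
proof -
  let ?S = "\<lambda>h x::real. poly (orth_poly z h) x"
  define H where "H j = (\<Prod>i=1..j. z i)" for j
  define A where "A = {x::real. ?S (Suc k) x = 0}"
  have H: "H j > 0" if "j \<le> k" for j
    unfolding H_def using pos that by (intro prod_pos) auto
  have card: "card A = Suc k" using orth_poly_real_roots[OF pos] by (simp add: A_def)
  then have fin: "finite A" by (simp add: card_ge_0_finite)
  have "\<exists>e. bij_betw e {..<Suc k} A"
    using ex_bij_betw_nat_finite[OF fin] card by (simp add: atLeast0LessThan)
  then obtain e where e: "bij_betw e {..<Suc k} A" by blast
  have eA: "e a \<in> A" if "a < Suc k" for a using e that by (auto simp: bij_betw_def)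
  have inj: "e a = e b \<longleftrightarrow> a = b" if "a < Suc k" "b < Suc k" for a b
    using e that by (auto simp: bij_betw_def inj_on_def)
  \<comment> \<open>The normalised kernel on the diagonal; \<open>1 / N x\<close> is the Christoffel number of the node \<open>x\<close>.\<close>
  define N where "N x = (\<Sum>j\<le>k. ?S j x * ?S j x / H j)" for x
  have N: "N x > 0" for x
  proof -
    have "0 < ?S 0 x * ?S 0 x / H 0" by (simp add: H_def)
    also have "\<dots> \<le> N x"
      unfolding N_def using H by (intro member_le_sum) (auto simp del: orth_poly.simps intro!: divide_nonneg_pos)
    finally show ?thesis .
  qed
  have kernel: "(\<Sum>j\<le>k. ?S j x * ?S j y / H j) = 0" if "x \<in> A" "y \<in> A" "x \<noteq> y" for x y
  proof -
    have "(x - y) * CD_kernel z k x y = 0"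
      unfolding Christoffel_Darboux using that by (simp add: A_def)
    then have "CD_kernel z k x y = 0" using that by simp
    then have "H k * (\<Sum>j\<le>k. ?S j x * ?S j y / H j) = 0"
      using CD_kernel_sum[of k z x y, OF pos] unfolding H_def[symmetric]
      by (simp del: orth_poly.simps)
    then show ?thesis using H[of k] by simp
  qed
  have dual: "(\<Sum>a<Suc k. ?S j (e a) / N (e a)) = (if j = 0 then 1 else 0)" if "j \<le> k" for j
  proof -
    have "(\<Sum>a<Suc k. (?S j (e a) / N (e a)) * (?S 0 (e a) / H 0)) = (if j = 0 then 1 else 0)"
    proof (rule square_right_inverse_is_left_inverse[where v = "\<lambda>j a. ?S j (e a) / N (e a)"
          and u = "\<lambda>a j. ?S j (e a) / H j"])
      fix a b assume ab: "a < Suc k" "b < Suc k"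
      have "(\<Sum>j<Suc k. ?S j (e a) / H j * (?S j (e b) / N (e b))) =
          (\<Sum>j\<le>k. ?S j (e a) * ?S j (e b) / H j) / N (e b)"
        unfolding lessThan_Suc_atMost sum_divide_distrib by (simp del: orth_poly.simps)
      also have "\<dots> = (if a = b then 1 else 0)"
      proof (cases "a = b")
        case True
        then show ?thesis using N[of "e b"] by (simp add: N_def[symmetric] del: orth_poly.simps)
      next
        case False
        then show ?thesis using kernel[of "e a" "e b"] eA ab inj by simp
      qed
      finally show "(\<Sum>j<Suc k. ?S j (e a) / H j * (?S j (e b) / N (e b))) = (if a = b then 1 else 0)" .
    qed (use that in auto)
    then show ?thesis by (simp add: H_def)
  qed
  have sumA: "(\<Sum>x\<in>A. f x) = (\<Sum>a<Suc k. f (e a))" for f :: "real \<Rightarrow> real"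
    using sum.reindex_bij_betw[OF e] by metis
  have quad: "(\<Sum>x\<in>A. 1 / N x * x ^ n) = path_weight (z(Suc k := 0)) n 0" for n
  proof -
    let ?w = "path_weight (z(Suc k := 0))"
    have "(\<Sum>x\<in>A. 1 / N x * x ^ n) = (\<Sum>x\<in>A. \<Sum>h\<le>k. ?w n h * (?S h x / N x))"
    proof (intro sum.cong refl)
      fix x assume "x \<in> A"
      then have "x ^ n = (\<Sum>h\<le>k. ?w n h * ?S h x)"
        by (intro power_at_orth_poly_root) (simp add: A_def)
      then show "1 / N x * x ^ n = (\<Sum>h\<le>k. ?w n h * (?S h x / N x))"
        by (simp add: sum_divide_distrib)
    qed
    also have "\<dots> = (\<Sum>h\<le>k. ?w n h * (\<Sum>a<Suc k. ?S h (e a) / N (e a)))"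
      by (subst sum.swap) (simp add: sum_distrib_left sumA del: orth_poly.simps sum.lessThan_Suc)
    also have "\<dots> = (\<Sum>h\<le>k. if h = 0 then ?w n h else 0)"
      by (intro sum.cong refl) (use dual in auto)
    finally show ?thesis by simp
  qed
  show thesis
  proof (rule that[of A "\<lambda>x. 1 / N x"])
    show "poly (orth_poly z (Suc k)) x = 0" if "x \<in> A" for x using that by (simp add: A_def)
    show "1 / N x > 0" for x using N by simp
  qed (use fin quad in auto)
qed

section \<open>The smallest value of the next moment\<close>

lemma halfline_measuresD:
  assumes "\<mu> \<in> halfline_measures"
  shows "prob_space \<mu>" "AE x in \<mu>. 0 \<le> x" "integrable \<mu> (\<lambda>x. x ^ k)"
    "sets \<mu> = sets borel"
  using assms by (auto simp: halfline_measures_def real_distribution_def real_distribution_axioms_def)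

lemma moment_0: "\<mu> \<in> halfline_measures \<Longrightarrow> moment \<mu> 0 = 1"
  using prob_space.prob_space[OF halfline_measuresD(1)] by (simp add: moment_def)

text \<open>The image under squaring of the quadrature measure on the zeros of the orthogonal polynomial of
degree \<open>k + 1\<close>.  It will attain the minimum of the moment of order \<open>k + 1\<close>.\<close>

lemma minimal_measure_exists:
  assumes pos: "\<And>i. 1 \<le> i \<Longrightarrow> i \<le> k \<Longrightarrow> z i > 0"
  obtains \<mu> where "\<mu> \<in> halfline_measures" "\<And>j. moment \<mu> j = dyck_moment (z(Suc k := 0)) j"
proof -
  obtain A w where A: "finite (A::real set)"
    and "\<And>x. x \<in> A \<Longrightarrow> poly (orth_poly z (Suc k)) x = 0"
    and w: "\<And>x. x \<in> A \<Longrightarrow> w x > (0::real)"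
    and quad: "\<And>n. (\<Sum>x\<in>A. w x * x ^ n) = path_weight (z(Suc k := 0)) n 0"
    by (rule Gauss_quadrature[of k z]) (rule pos that; assumption)+
  define \<nu> where "\<nu> = point_measure A (\<lambda>x. ennreal (w x))"
  define \<mu> where "\<mu> = distr \<nu> borel (\<lambda>x. x\<^sup>2)"
  have total: "(\<Sum>x\<in>A. w x) = 1" using quad[of 0] by simp
  interpret \<nu>: prob_space \<nu>
  proof (rule prob_spaceI)
    show "emeasure \<nu> (space \<nu>) = 1"
      using A w total unfolding \<nu>_def
      by (subst emeasure_point_measure_finite)
         (auto simp: space_point_measure sum_ennreal less_imp_le)
  qed
  have meas: "f \<in> measurable \<nu> borel" for f :: "real \<Rightarrow> real"
    by (simp add: \<nu>_def)
  have "\<mu> \<in> halfline_measures"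
    unfolding halfline_measures_def
  proof (intro CollectI conjI allI)
    show "real_distribution \<mu>" unfolding \<mu>_def by (rule \<nu>.real_distribution_distr) (rule meas)
    show "AE x in \<mu>. 0 \<le> x" unfolding \<mu>_def by (subst AE_distr_iff) (auto simp: meas)
    show "integrable \<mu> (\<lambda>x. x ^ k)" for k
      unfolding \<mu>_def using A by (subst integrable_distr_eq) (auto simp: meas \<nu>_def intro: integrable_point_measure_finite)
  qed
  moreover have "moment \<mu> j = dyck_moment (z(Suc k := 0)) j" for j
  proof -
    have "moment \<mu> j = (\<integral>x. (x\<^sup>2) ^ j \<partial>\<nu>)"
      unfolding moment_def \<mu>_def by (subst integral_distr) (auto simp: meas)
    also have "\<dots> = (\<Sum>x\<in>A. w x * x ^ (2 * j))"
      unfolding \<nu>_def using A w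
      by (subst lebesgue_integral_point_measure_finite) (auto simp: power_mult less_imp_le)
    finally show ?thesis unfolding quad dyck_moment_def .
  qed
  ultimately show thesis by (rule that)
qed

text \<open>Let \<open>S\<close> be the orthogonal polynomial of degree \<open>k + 1\<close>.  Its square is even, so \<open>S(y)\<^sup>2 = q(y\<^sup>2)\<close> with a
monic polynomial \<open>q\<close> of degree \<open>k + 1\<close> that is nonnegative on the half-line.  Integrating \<open>q\<close>
against \<open>\<mu>\<close> gives a nonnegative number, and against the measure located at the squared zeros of \<open>S\<close>
it gives zero.  Since the two measures agree in the moments up to order \<open>k\<close>, comparing the two
integrals compares the moments of order \<open>k + 1\<close>.\<close>

lemma moment_lower_bound:
  assumes pos: "\<And>i. 1 \<le> i \<Longrightarrow> i \<le> k \<Longrightarrow> z i > 0"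
    and \<mu>: "\<mu> \<in> halfline_measures"
    and eq: "\<And>i. 1 \<le> i \<Longrightarrow> i \<le> k \<Longrightarrow> moment \<mu> i = dyck_moment z i"
  shows "dyck_moment (z(Suc k := 0)) (Suc k) \<le> moment \<mu> (Suc k)"
proof -
  let ?S = "orth_poly z (Suc k) :: real poly"
  define c where "c j = coeff (?S * ?S) (2 * j)" for j
  define q where "q x = (\<Sum>j\<le>Suc k. c j * x ^ j)" for x
  have degS: "degree (?S * ?S) = 2 * Suc k"
    using degree_orth_poly[of z "Suc k", where 'a = real] by (subst degree_mult_eq) auto
  have cS: "c (Suc k) = 1"
    using coeff_mult_degree_sum[of ?S ?S] coeff_orth_poly_top[of z "Suc k", where 'a = real]
      degree_orth_poly[of z "Suc k", where 'a = real] 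
    by (simp add: c_def mult_2 del: orth_poly.simps)
  \<comment> \<open>Averaging the expansion of the square over \<open>y\<close> and \<open>- y\<close> cancels the odd powers, and the square
    is invariant under \<open>y \<mapsto> - y\<close>.\<close>
  have even: "q (y\<^sup>2) = (poly ?S y)\<^sup>2" for y
  proof -
    have "poly (?S * ?S) y + poly (?S * ?S) (- y)
        = (\<Sum>i\<le>2 * Suc k. coeff (?S * ?S) i * (y ^ i + (- y) ^ i))"
      unfolding poly_altdef degS sum.distrib[symmetric] by (simp add: distrib_left)
    also have "\<dots> = (\<Sum>i\<in>{i. i \<le> 2 * Suc k \<and> even i}. coeff (?S * ?S) i * (2 * y ^ i))"
      by (rule sum.mono_neutral_cong_right) auto
    also have "\<dots> = (\<Sum>j\<le>Suc k. c j * (2 * y ^ (2 * j)))"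
      unfolding c_def
      by (rule sum.reindex_bij_witness[of _ "\<lambda>j. 2 * j" "\<lambda>i. i div 2"]) auto
    also have "\<dots> = 2 * q (y\<^sup>2)"
      unfolding q_def sum_distrib_left power_mult by (intro sum.cong refl mult.left_commute)
    finally have "2 * q (y\<^sup>2) = poly (?S * ?S) y + poly (?S * ?S) (- y)" by simp
    also have "\<dots> = (poly ?S y)\<^sup>2 + (poly ?S (- y))\<^sup>2" 
      unfolding poly_mult power2_eq_square ..
    also have "(poly ?S (- y))\<^sup>2 = (poly ?S y)\<^sup>2"
      unfolding poly_orth_poly_minus by (simp add: power_mult_distrib flip: power_mult del: orth_poly.simps)
    finally show ?thesis by simp
  qed
  have "q x \<ge> 0" if "x \<ge> 0" for x using even[of "sqrt x"] that by simp
  then have nonneg: "(\<integral>x. q x \<partial>\<mu>) \<ge> 0"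
    using halfline_measuresD(2)[OF \<mu>] by (intro integral_nonneg_AE) auto
  have "(\<integral>x. q x \<partial>\<mu>) = (\<Sum>j\<le>Suc k. c j * moment \<mu> j)"
    unfolding q_def moment_def using halfline_measuresD(3)[OF \<mu>]
    by (subst Bochner_Integration.integral_sum) auto
  also have "\<dots> = moment \<mu> (Suc k) + (\<Sum>j\<le>k. c j * dyck_moment z j)"
  proof -
    have "c j * moment \<mu> j = c j * dyck_moment z j" if "j \<le> k" for j
      using eq[of j] moment_0[OF \<mu>] that by (cases "j = 0") auto
    then have "(\<Sum>j\<le>k. c j * moment \<mu> j) = (\<Sum>j\<le>k. c j * dyck_moment z j)"
      by (intro sum.cong) auto
    then show ?thesis using cS by simp
  qed
  finally have general: "moment \<mu> (Suc k) + (\<Sum>j\<le>k. c j * dyck_moment z j) \<ge> 0"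
    using nonneg by simp
  obtain A w where A: "finite (A::real set)"
    and root: "\<And>x. x \<in> A \<Longrightarrow> poly ?S x = 0"
    and "\<And>x. x \<in> A \<Longrightarrow> w x > 0"
    and quad: "\<And>n. (\<Sum>x\<in>A. w x * x ^ n) = path_weight (z(Suc k := 0)) n 0"
    by (rule Gauss_quadrature[of k z]) (rule pos that; assumption)+
  have "0 = (\<Sum>x\<in>A. w x * q (x\<^sup>2))" unfolding even using root by simp
  also have "\<dots> = (\<Sum>j\<le>Suc k. c j * (\<Sum>x\<in>A. w x * x ^ (2 * j)))"
    unfolding q_def sum_distrib_left power_mult by (subst sum.swap) (intro sum.cong refl mult.left_commute)
  also have "\<dots> = (\<Sum>j\<le>Suc k. c j * dyck_moment (z(Suc k := 0)) j)"
    unfolding quad dyck_moment_def ..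
  also have "\<dots> = dyck_moment (z(Suc k := 0)) (Suc k) + (\<Sum>j\<le>k. c j * dyck_moment z j)"
  proof -
    have "dyck_moment (z(Suc k := 0)) j = dyck_moment z j" if "j \<le> k" for j
      using that by (intro dyck_moment_cong) auto
    then show ?thesis using cS by simp
  qed
  finally show ?thesis using general by simp
qed

lemma lower_moment_dyck:
  assumes pos: "\<And>i. 1 \<le> i \<Longrightarrow> i \<le> k \<Longrightarrow> z i > 0"
    and eq: "\<And>i. 1 \<le> i \<Longrightarrow> i \<le> k \<Longrightarrow> m i = dyck_moment z i"
  shows "lower_moment m (Suc k) = dyck_moment (z(Suc k := 0)) (Suc k)"
proof -
  obtain \<mu> where \<mu>: "\<mu> \<in> halfline_measures" "\<And>j. moment \<mu> j = dyck_moment (z(Suc k := 0)) j"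
    by (rule minimal_measure_exists[of k z]) (rule pos that; assumption)+
  have m: "moment \<mu> i = m i" if "i \<in> {1..<Suc k}" for i
  proof -
    have "dyck_moment (z(Suc k := 0)) i = dyck_moment z i"
      using that by (intro dyck_moment_cong) auto
    then show ?thesis unfolding \<mu>(2) using eq[of i] that by simp
  qed
  let ?P = "\<lambda>x. x \<in> {moment \<mu> (Suc k) | \<mu>. \<mu> \<in> halfline_measures \<and> (\<forall>i\<in>{1..<Suc k}. moment \<mu> i = m i)}"
  have "(LEAST x. ?P x) = dyck_moment (z(Suc k := 0)) (Suc k)"
  proof (rule Least_equality)
    show "?P (dyck_moment (z(Suc k := 0)) (Suc k))"
      using \<mu>(1) m unfolding \<mu>(2)[symmetric] by blast
    fix y assume "?P y"
    then obtain \<nu> where \<nu>: "\<nu> \<in> halfline_measures" "\<forall>i\<in>{1..<Suc k}. moment \<nu> i = m i"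
      "y = moment \<nu> (Suc k)" by blast
    show "dyck_moment (z(Suc k := 0)) (Suc k) \<le> y"
      unfolding \<nu>(3) by (rule moment_lower_bound[OF pos \<nu>(1)]) (use \<nu>(2) eq in auto)
  qed
  then show ?thesis by (simp add: lower_moment_def)
qed

lemma moment_gap_dyck:
  assumes pos: "\<And>i. 1 \<le> i \<Longrightarrow> i < k \<Longrightarrow> z i > 0"
    and eq: "\<And>i. 1 \<le> i \<Longrightarrow> i \<le> k \<Longrightarrow> m i = dyck_moment z i"
  shows "moment_gap m k = (\<Prod>i=1..k. z i)"
proof (cases k)
  case 0
  then show ?thesis by (simp add: moment_gap_def lower_moment_def)
next
  case (Suc l)
  have "lower_moment m k = dyck_moment (z(k := 0)) k"
    unfolding Suc by (rule lower_moment_dyck) (use assms Suc in auto)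
  then show ?thesis
    using dyck_moment_peak[of k z] eq[of k] Suc by (simp add: moment_gap_def)
qed

text \<open>The gaps are the products \<open>z\<^sub>1 \<cdots> z\<^sub>k\<close>, and \<open>z\<^sub>k\<close> is a quotient of consecutive ones.\<close>

lemma z_coord_dyck:
  assumes pos: "\<And>i. 1 \<le> i \<Longrightarrow> i \<le> k \<Longrightarrow> z i > 0" and "1 \<le> k"
    and eq: "\<And>i. 1 \<le> i \<Longrightarrow> i \<le> k \<Longrightarrow> m i = dyck_moment z i"
  shows "z_coord m k = z k"
proof -
  obtain l where l: "k = Suc l" using \<open>1 \<le> k\<close> by (cases k) auto
  have "(\<Prod>i=1..l. z i) > 0" using pos l by (intro prod_pos) auto
  moreover have "moment_gap m k = (\<Prod>i=1..k. z i)"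
    by (rule moment_gap_dyck) (use assms in simp_all)
  moreover have "moment_gap m l = (\<Prod>i=1..l. z i)"
    by (rule moment_gap_dyck) (use assms l in simp_all)
  moreover have "(\<Prod>i=1..k. z i) = (\<Prod>i=1..l. z i) * z k" by (simp add: l)
  ultimately show ?thesis unfolding z_coord_def using l by (metis diff_Suc_1 less_irrefl nonzero_mult_div_cancel_left)
qed

lemma dyck_moments_in_moment_space:
  assumes "\<And>i. i \<in> {1..n} \<Longrightarrow> z i > 0"
  shows "(\<lambda>i\<in>{1..n}. dyck_moment z i) \<in> moment_space n"
proof -
  obtain \<mu> where \<mu>: "\<mu> \<in> halfline_measures" "\<And>j. moment \<mu> j = dyck_moment (z(Suc n := 0)) j"
    by (rule minimal_measure_exists[of n z]) (use assms in auto)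
  have "dyck_moment z i = moment \<mu> i" if "i \<in> {1..n}" for i
    unfolding \<mu>(2) using that by (intro dyck_moment_cong) auto
  then have "(\<lambda>i\<in>{1..n}. dyck_moment z i) = (\<lambda>i\<in>{1..n}. moment \<mu> i)" by auto
  then show ?thesis unfolding moment_space_def using \<mu>(1) by blast
qed

section \<open>Inversion of the moment map and change of variables\<close>

text \<open>The inverse of the map from weights to Dyck moments, computed successively.  The coordinates beyond
\<open>j\<close> are zero, so that \<open>dyck_moment (stieltjes_coords m j) (Suc j)\<close> is the minimal value of the next
moment.\<close>

primrec stieltjes_coords :: "(nat \<Rightarrow> real) \<Rightarrow> nat \<Rightarrow> nat \<Rightarrow> real" where
  "stieltjes_coords m 0 = (\<lambda>_. 0)"
| "stieltjes_coords m (Suc j) = (stieltjes_coords m j)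
     (Suc j := (m (Suc j) - dyck_moment (stieltjes_coords m j) (Suc j)) / (\<Prod>i=1..j. stieltjes_coords m j i))"

lemma stieltjes_coords_above: "j < i \<Longrightarrow> stieltjes_coords m j i = 0"
  by (induction j) auto

lemma stieltjes_coords_cong:
  "(\<And>i. i \<in> {1..n} \<Longrightarrow> m i = m' i) \<Longrightarrow> stieltjes_coords m n = stieltjes_coords m' n"
  by (induction n) auto

lemma stieltjes_coords_dyck:
  assumes "\<And>i. i \<in> {1..n} \<Longrightarrow> m i = dyck_moment z i" "\<And>i. i \<in> {1..n} \<Longrightarrow> z i > 0" "i \<in> {1..n}"
  shows "stieltjes_coords m n i = z i"
  using assms
proof (induction n arbitrary: i)
  case (Suc n)
  have IH: "stieltjes_coords m n i = z i" if "i \<in> {1..n}" for i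
    using Suc.prems that by (intro Suc.IH) auto
  have H: "(\<Prod>i=1..n. stieltjes_coords m n i) = (\<Prod>i=1..n. z i)"
    using IH by (intro prod.cong) auto
  have pos: "(\<Prod>i=1..n. z i) > 0" using Suc.prems(2) by (intro prod_pos) auto
  have R: "dyck_moment (stieltjes_coords m n) (Suc n) = dyck_moment (z(Suc n := 0)) (Suc n)"
    using IH by (intro dyck_moment_cong) (auto simp: stieltjes_coords_above)
  have "m (Suc n) = dyck_moment (z(Suc n := 0)) (Suc n) + (\<Prod>i=1..n. z i) * z (Suc n)"
    using Suc.prems(1)[of "Suc n"] dyck_moment_peak[of "Suc n" z] by simp
  then have "stieltjes_coords m (Suc n) (Suc n) = z (Suc n)"
    using pos by (simp only: stieltjes_coords.simps fun_upd_same H R) (simp del: prod_zero_iff)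
  then show ?case using IH[of i] Suc.prems(3) by (cases "i = Suc n") auto
qed simp

text \<open>The sequences whose first \<open>n\<close> entries are the Dyck moments of positive weights
(\<open>dyck_stieltjes_coords\<close>, \<open>dyck_moments_in_domain\<close>).\<close>

definition stieltjes_domain :: "nat \<Rightarrow> (nat \<Rightarrow> real) set" where
  "stieltjes_domain n = {m. \<forall>i\<in>{1..n}. stieltjes_coords m n i > 0}"

lemma stieltjes_domain_prod_pos:
  "m \<in> stieltjes_domain n \<Longrightarrow> (\<Prod>i=1..n. stieltjes_coords m n i) > 0"
  by (intro prod_pos) (auto simp: stieltjes_domain_def)

lemma stieltjes_domain_Suc:
  "m \<in> stieltjes_domain (Suc n) \<longleftrightarrow> m \<in> stieltjes_domain n \<and>
     dyck_moment (stieltjes_coords m n) (Suc n) < m (Suc n)"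
proof -
  have "m \<in> stieltjes_domain (Suc n) \<longleftrightarrow> m \<in> stieltjes_domain n \<and> stieltjes_coords m (Suc n) (Suc n) > 0"
    by (auto simp: stieltjes_domain_def atLeastAtMostSuc_conv)
  then show ?thesis
    using stieltjes_domain_prod_pos[of m n] by (auto simp: zero_less_divide_iff)
qed

lemma dyck_stieltjes_coords:
  "m \<in> stieltjes_domain n \<Longrightarrow> i \<in> {1..n} \<Longrightarrow> dyck_moment (stieltjes_coords m n) i = m i"
proof (induction n arbitrary: i)
  case (Suc n)
  let ?z = "stieltjes_coords m (Suc n)"
  have m: "m \<in> stieltjes_domain n" using Suc.prems stieltjes_domain_Suc by simp
  show ?case
  proof (cases "i = Suc n")
    case True
    have "?z(Suc n := 0) = stieltjes_coords m n"
      by (auto simp: fun_eq_iff stieltjes_coords_above)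
    then have "dyck_moment ?z (Suc n)
        = dyck_moment (stieltjes_coords m n) (Suc n) + (\<Prod>i=1..Suc n. ?z i)"
      using dyck_moment_peak[of "Suc n" ?z] by (simp del: stieltjes_coords.simps)
    moreover have "(\<Prod>i=1..n. ?z i) = (\<Prod>i=1..n. stieltjes_coords m n i)"
      by (intro prod.cong) auto
    then have "(\<Prod>i=1..Suc n. ?z i) = (\<Prod>i=1..n. stieltjes_coords m n i) * ?z (Suc n)"
      by (simp only: prod.cl_ivl_Suc) simp
    moreover have "(\<Prod>i=1..n. stieltjes_coords m n i) * ?z (Suc n)
        = m (Suc n) - dyck_moment (stieltjes_coords m n) (Suc n)"
      using stieltjes_domain_prod_pos[OF m] by (simp del: prod_zero_iff)
    ultimately show ?thesis unfolding True by linarith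
  next
    case False
    then have "dyck_moment ?z i = dyck_moment (stieltjes_coords m n) i"
      using Suc.prems by (intro dyck_moment_cong) auto
    then show ?thesis using Suc.IH[OF m] Suc.prems False by (simp del: stieltjes_coords.simps)
  qed
qed simp

lemma continuous_on_path_weight:
  assumes "\<And>i. continuous_on S (\<lambda>x. f x i)"
  shows "continuous_on S (\<lambda>x. path_weight (f x) n h)"
proof (induction n arbitrary: h)
  case (Suc n)
  show ?case
    using Suc.IH assms by (cases h) (auto intro!: continuous_intros)
qed simp

lemma measurable_path_weight:
  assumes "\<And>i. (\<lambda>x. f x i) \<in> borel_measurable M"
  shows "(\<lambda>x. path_weight (f x) n h) \<in> borel_measurable M"
proof (induction n arbitrary: h)
  case (Suc n)
  note [measurable] = Suc.IH assms
  show ?case by (cases h) simp_all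
qed simp

lemma measurable_stieltjes_coords:
  assumes "\<And>i. i \<in> {1..n} \<Longrightarrow> (\<lambda>x. f x i) \<in> borel_measurable M"
  shows "(\<lambda>x. stieltjes_coords (f x) n i) \<in> borel_measurable M"
  using assms
proof (induction n arbitrary: i)
  case (Suc n)
  have [measurable]: "(\<lambda>x. stieltjes_coords (f x) n i) \<in> borel_measurable M" for i
    using Suc.prems by (intro Suc.IH) auto
  have [measurable]: "(\<lambda>x. dyck_moment (stieltjes_coords (f x) n) j) \<in> borel_measurable M" for j
    unfolding dyck_moment_def by (intro measurable_path_weight) auto
  have [measurable]: "(\<lambda>x. f x (Suc n)) \<in> borel_measurable M"
    using Suc.prems by simp
  show ?case by (cases "i = Suc n") simp_all
qed simp

text \<open>Openness and continuity are proved together: the next coordinate is a rational function of the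
moments and the earlier coordinates, with a denominator that does not vanish on the domain.\<close>

lemma stieltjes_domain_open_continuous:
  "open (stieltjes_domain n) \<and> (\<forall>i. continuous_on (stieltjes_domain n) (\<lambda>m. stieltjes_coords m n i))"
proof (induction n)
  case 0
  then show ?case by (simp add: stieltjes_domain_def)
next
  case (Suc n)
  let ?D = "stieltjes_domain n"
  have D: "open ?D" and [continuous_intros]: "\<And>i. continuous_on ?D (\<lambda>m. stieltjes_coords m n i)"
    using Suc by auto
  have [continuous_intros]: "continuous_on ?D (\<lambda>m. dyck_moment (stieltjes_coords m n) (Suc n))"
    unfolding dyck_moment_def by (intro continuous_on_path_weight continuous_intros)
  have [continuous_intros]: "continuous_on ?D (\<lambda>m. m (Suc n))"
    by (rule continuous_on_subset[OF continuous_on_product_coordinates]) simp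
  have prod: "m \<in> ?D \<Longrightarrow> (\<Prod>i=1..n. stieltjes_coords m n i) \<noteq> 0" for m
    using stieltjes_domain_prod_pos[of m n] by (metis less_irrefl)
  have cont: "continuous_on ?D (\<lambda>m. stieltjes_coords m (Suc n) i)" for i
    by (cases "i = Suc n") (use prod in \<open>auto intro!: continuous_intros simp del: prod_zero_iff\<close>)
  have "continuous_on ?D (\<lambda>m. m (Suc n) - dyck_moment (stieltjes_coords m n) (Suc n))"
    by (intro continuous_intros)
  then have "open ((\<lambda>m. m (Suc n) - dyck_moment (stieltjes_coords m n) (Suc n)) -` {0<..} \<inter> ?D)"
    by (intro continuous_on_open_vimage[OF D, THEN iffD1, rule_format]) auto
  moreover have "(\<lambda>m. m (Suc n) - dyck_moment (stieltjes_coords m n) (Suc n)) -` {0<..} \<inter> ?D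
      = stieltjes_domain (Suc n)"
    by (auto simp: stieltjes_domain_Suc)
  moreover have "stieltjes_domain (Suc n) \<subseteq> ?D" by (auto simp: stieltjes_domain_Suc)
  ultimately show ?case
    using continuous_on_subset[OF cont] by (simp del: stieltjes_coords.simps)
qed

lemma continuous_map_Rn_inclusion:
  "continuous_map (Rn_topology n) (euclidean :: (nat \<Rightarrow> real) topology) (\<lambda>x. x)"
proof -
  have "continuous_map (Rn_topology n) euclideanreal (\<lambda>x. x k)" for k
  proof (cases "k \<in> {1..n}")
    case True
    then show ?thesis by (rule continuous_map_product_projection)
  next
    case False
    have "continuous_map (Rn_topology n) euclideanreal (\<lambda>x. undefined)" by simp
    then show ?thesis
      by (rule continuous_map_eq) (use False in \<open>auto simp: PiE_def extensional_def\<close>)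
  qed
  then show ?thesis
    unfolding euclidean_product_topology[symmetric] continuous_map_componentwise_UNIV by blast
qed

text \<open>The domain is open and all its points are moment vectors by Gauss quadrature.\<close>

lemma stieltjes_domain_subset_interior:
  assumes "m \<in> extensional {1..n}" "m \<in> stieltjes_domain n"
  shows "m \<in> Rn_topology n interior_of moment_space n"
proof -
  let ?U = "{x \<in> topspace (Rn_topology n). x \<in> stieltjes_domain n}"
  have "openin (Rn_topology n) ?U"
    using stieltjes_domain_open_continuous[of n]
    by (intro openin_continuous_map_preimage[OF continuous_map_Rn_inclusion]) auto
  moreover have "?U \<subseteq> moment_space n"
  proof
    fix m assume m: "m \<in> ?U"
    then have "m = (\<lambda>i\<in>{1..n}. dyck_moment (stieltjes_coords m n) i)"
      by (auto simp: fun_eq_iff dyck_stieltjes_coords PiE_def extensional_def)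
    moreover have "(\<lambda>i\<in>{1..n}. dyck_moment (stieltjes_coords m n) i) \<in> moment_space n"
      using m by (intro dyck_moments_in_moment_space) (auto simp: stieltjes_domain_def)
    ultimately show "m \<in> moment_space n" by simp
  qed
  ultimately have "?U \<subseteq> Rn_topology n interior_of moment_space n"
    by (intro interior_of_maximal)
  then show ?thesis using assms by (auto simp: PiE_def)
qed

definition dyck_moments :: "nat \<Rightarrow> (nat \<Rightarrow> real) \<Rightarrow> (nat \<Rightarrow> real)" where
  "dyck_moments n z = (\<lambda>i\<in>{1..n}. dyck_moment z i)"

lemma stieltjes_coords_dyck_moments:
  assumes "\<And>i. i \<in> {1..n} \<Longrightarrow> z i > 0" "i \<in> {1..n}"
  shows "stieltjes_coords (dyck_moments n z) n i = z i"
  by (rule stieltjes_coords_dyck) (use assms in \<open>auto simp: dyck_moments_def\<close>)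

lemma dyck_moments_in_domain:
  assumes "\<And>i. i \<in> {1..n} \<Longrightarrow> z i > 0"
  shows "dyck_moments n z \<in> stieltjes_domain n"
  unfolding stieltjes_domain_def using stieltjes_coords_dyck_moments[of n z] assms by auto

abbreviation positive_orthant :: "nat \<Rightarrow> (nat \<Rightarrow> real) set" where
  "positive_orthant n \<equiv> {z. \<forall>i\<in>{1..n}. z i > 0}"

lemma measurable_dyck_moment:
  assumes "\<And>i. i \<in> {1..n} \<Longrightarrow> (\<lambda>x. f x i) \<in> borel_measurable M" "j \<le> n"
  shows "(\<lambda>x. dyck_moment (f x) j) \<in> borel_measurable M"
proof -
  have "(\<lambda>x. if i \<in> {1..n} then f x i else 0) \<in> borel_measurable M" for i
    by (cases "i \<in> {1..n}") (simp_all only: assms(1) if_True if_False borel_measurable_const)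
  then have "(\<lambda>x. dyck_moment (\<lambda>i. if i \<in> {1..n} then f x i else 0) j) \<in> borel_measurable M"
    unfolding dyck_moment_def by (rule measurable_path_weight)
  moreover have "dyck_moment (\<lambda>i. if i \<in> {1..n} then f x i else 0) j = dyck_moment (f x) j" for x
    using assms(2) by (intro dyck_moment_cong) auto
  ultimately show ?thesis by simp
qed

lemma measurable_dyck_moments:
  assumes "\<And>i. i \<in> {1..n} \<Longrightarrow> sets (M i) = sets borel"
  shows "dyck_moments n \<in> measurable (Pi\<^sub>M {1..n} M) (Rn_borel n)"
  unfolding dyck_moments_def
proof (rule measurable_restrict)
  fix j assume j: "j \<in> {1..n}"
  have "(\<lambda>x. x i) \<in> borel_measurable (Pi\<^sub>M {1..n} M)" if "i \<in> {1..n}" for i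
    using measurable_component_singleton[OF that, of M] assms[OF that] measurable_cong_sets by blast
  then show "(\<lambda>x. dyck_moment x j) \<in> borel_measurable (Pi\<^sub>M {1..n} M)"
    by (rule measurable_dyck_moment) (use j in auto)
qed

interpretation lborels: product_sigma_finite "\<lambda>_::nat. lborel :: real measure" ..

lemma measurable_Rn_lebesgue_component:
  "i \<in> {1..n} \<Longrightarrow> (\<lambda>x. x i) \<in> borel_measurable (Rn_lebesgue n)"
  using measurable_component_singleton[of i "{1..n}" "\<lambda>_. lborel"] by simp

text \<open>The map is triangular: with \<open>z\<^sub>1, \<dots>, z\<^sub>n\<close> fixed, the moment of order \<open>n + 1\<close> is an affine function of
\<open>z\<^bsub>n+1\<^esub>\<close> with slope \<open>z\<^sub>1 \<cdots> z\<^sub>n\<close>.  Thus an affine substitution in the innermost integral reduces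
dimension \<open>n + 1\<close> to dimension \<open>n\<close>, and the slopes multiply up to the Jacobian.\<close>

lemma stieltjes_change_of_variables:
  assumes "F \<in> borel_measurable (Rn_lebesgue n)"
  shows "(\<integral>\<^sup>+z. indicator (positive_orthant n) z * ennreal (\<Prod>i=1..n. z i ^ (n - i)) * F (dyck_moments n z)
            \<partial>Rn_lebesgue n)
       = (\<integral>\<^sup>+m. indicator (stieltjes_domain n) m * F m \<partial>Rn_lebesgue n)"
  using assms
proof (induction n arbitrary: F)
  case 0
  then show ?case
    by (simp add: stieltjes_domain_def dyck_moments_def PiM_empty nn_integral_count_space_finite)
next
  case (Suc n)
  note F[measurable] = Suc.prems
  let ?I = "{1..n}"
  have ins: "{1..Suc n} = insert (Suc n) ?I" by auto
  note split = lborels.product_nn_integral_insert[of ?I "Suc n", folded ins]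
  define R where "R z = dyck_moment (z(Suc n := 0)) (Suc n)" for z :: "nat \<Rightarrow> real"
  define H where "H z = (\<Prod>i=1..n. z i)" for z :: "nat \<Rightarrow> real"
  define J where "J z = (\<Prod>i=1..n. z i ^ (n - i))" for z :: "nat \<Rightarrow> real"
  define K where "K m = (\<integral>\<^sup>+u. indicator {dyck_moment (stieltjes_coords m n) (Suc n)<..} u * F (m(Suc n := u)) \<partial>lborel)"
    for m :: "nat \<Rightarrow> real"
  have coords[measurable]: "(\<lambda>m. stieltjes_coords m n i) \<in> borel_measurable (Rn_lebesgue n)" for i
    by (rule measurable_stieltjes_coords) (rule measurable_Rn_lebesgue_component)
  have lower[measurable]: "(\<lambda>m. dyck_moment (stieltjes_coords m n) (Suc n)) \<in> borel_measurable (Rn_lebesgue n)"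
    unfolding dyck_moment_def by (rule measurable_path_weight) (rule coords)
  have upd[measurable]: "(\<lambda>p. (fst p)(Suc n := snd p)) \<in> measurable (Rn_lebesgue n \<Otimes>\<^sub>M lborel) (Rn_lebesgue (Suc n))"
    using measurable_add_dim[of "Suc n" ?I "\<lambda>_. lborel"] unfolding ins by (simp add: case_prod_unfold)
  have K[measurable]: "K \<in> borel_measurable (Rn_lebesgue n)"
  proof -
    have [measurable]: "Measurable.pred (Rn_lebesgue n \<Otimes>\<^sub>M lborel)
        (\<lambda>p. dyck_moment (stieltjes_coords (fst p) n) (Suc n) < snd p)"
    proof -
      have "(\<lambda>p. dyck_moment (stieltjes_coords (fst p) n) (Suc n))
          \<in> borel_measurable (Rn_lebesgue n \<Otimes>\<^sub>M (lborel :: real measure))"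
        by (rule measurable_compose[OF measurable_fst lower])
      moreover have "snd \<in> borel_measurable (Rn_lebesgue n \<Otimes>\<^sub>M (lborel :: real measure))"
        using measurable_snd[of "Rn_lebesgue n" "lborel :: real measure"] by (simp only: measurable_lborel1)
      ultimately show ?thesis unfolding pred_def by (rule borel_measurable_less)
    qed
    have [measurable]: "(\<lambda>p. F ((fst p)(Suc n := snd p))) \<in> borel_measurable (Rn_lebesgue n \<Otimes>\<^sub>M lborel)"
      by (rule measurable_compose[OF upd F])
    have "(\<lambda>p. indicator {p. dyck_moment (stieltjes_coords (fst p) n) (Suc n) < snd p} p
        * F ((fst p)(Suc n := snd p))) \<in> borel_measurable (Rn_lebesgue n \<Otimes>\<^sub>M lborel)"
      by measurable
    then show ?thesis
      unfolding K_def
      by (intro lborel.borel_measurable_nn_integral) (simp add: case_prod_unfold indicator_def)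
  qed
  have F_upd: "(\<lambda>u. F (x(Suc n := u))) \<in> borel_measurable borel" if "x \<in> space (Rn_lebesgue n)" for x
    using measurable_compose[OF measurable_Pair1'[OF that] measurable_compose[OF upd F]]
    by (simp only: fst_conv snd_conv measurable_lborel2)
  have Fdm: "(\<lambda>z. F (dyck_moments (Suc n) z)) \<in> borel_measurable (Rn_lebesgue (Suc n))"
    using F measurable_dyck_moments[of "Suc n" "\<lambda>_. lborel"]
    by (intro measurable_compose[OF _ F]) (simp cong: measurable_cong_sets sets_PiM_cong)
  have inner: "(\<integral>\<^sup>+y. indicator (positive_orthant (Suc n)) (z(Suc n := y))
        * ennreal (\<Prod>i=1..Suc n. (z(Suc n := y)) i ^ (Suc n - i)) * F (dyck_moments (Suc n) (z(Suc n := y))) \<partial>lborel)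
      = indicator (positive_orthant n) z * ennreal (J z) * K (dyck_moments n z)" (is "?L = ?R")
    if z: "z \<in> space (Rn_lebesgue n)" for z
  proof (cases "z \<in> positive_orthant n")
    case False
    then have "z(Suc n := y) \<notin> positive_orthant (Suc n)" for y
      by (auto simp: atLeastAtMostSuc_conv)
    then show ?thesis using False by simp
  next
    case True
    then have zpos: "i \<in> {1..n} \<Longrightarrow> z i > 0" for i by simp
    have Hpos: "H z > 0" unfolding H_def using zpos by (intro prod_pos) auto
    have Jpos: "J z \<ge> 0" unfolding J_def using zpos by (intro prod_nonneg) (auto intro: less_imp_le)
    have R: "dyck_moment (stieltjes_coords (dyck_moments n z) n) (Suc n) = R z"
      unfolding R_def using stieltjes_coords_dyck_moments[of n z] zpos
      by (intro dyck_moment_cong) (auto simp: stieltjes_coords_above)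
    have jac: "(\<Prod>i=1..Suc n. (z(Suc n := y)) i ^ (Suc n - i)) = J z * H z" for y
    proof -
      have "(\<Prod>i=1..Suc n. (z(Suc n := y)) i ^ (Suc n - i)) = (\<Prod>i=1..n. z i ^ (n - i) * z i)"
        by (simp, intro prod.cong) (auto simp: Suc_diff_le)
      then show ?thesis by (simp add: J_def H_def prod.distrib)
    qed
    have mom: "dyck_moments (Suc n) (z(Suc n := y)) = (dyck_moments n z)(Suc n := R z + H z * y)" for y
    proof (rule ext)
      fix j
      have "dyck_moment (z(Suc n := y)) j = dyck_moment z j" if "j \<le> n"
        using that by (intro dyck_moment_cong) auto
      moreover have "dyck_moment (z(Suc n := y)) (Suc n) = R z + H z * y"
        using dyck_moment_peak[of "Suc n" "z(Suc n := y)"] by (simp add: R_def H_def)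
      ultimately show "dyck_moments (Suc n) (z(Suc n := y)) j = ((dyck_moments n z)(Suc n := R z + H z * y)) j"
        by (auto simp: dyck_moments_def)
    qed
    have dm: "dyck_moments n z \<in> space (Rn_lebesgue n)" by (auto simp: dyck_moments_def space_PiM)
    have h: "(\<lambda>u. indicator {R z<..} u * F ((dyck_moments n z)(Suc n := u))) \<in> borel_measurable borel"
      by (intro borel_measurable_times_ennreal F_upd[OF dm] borel_measurable_indicator) simp
    have g: "(\<lambda>y. indicator {R z<..} (R z + H z * y) * F ((dyck_moments n z)(Suc n := R z + H z * y)))
        \<in> borel_measurable borel"
      by (rule measurable_compose[OF _ h]) simp
    \<comment> \<open>In the new variable \<open>u = R z + H z * y\<close>, the condition \<open>y > 0\<close> says that the moment exceeds its
      minimum.\<close>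
    have orth: "indicator (positive_orthant (Suc n)) (z(Suc n := y)) = indicator {R z<..} (R z + H z * y)" for y
    proof -
      have "z(Suc n := y) \<in> positive_orthant (Suc n) \<longleftrightarrow> 0 < y"
        using True by (auto simp: atLeastAtMostSuc_conv)
      moreover have "0 < H z * y \<longleftrightarrow> 0 < y" using Hpos by (simp add: zero_less_mult_iff)
      ultimately show ?thesis by (simp add: indicator_def)
    qed
    have "?L = (\<integral>\<^sup>+y. ennreal (J z) * (ennreal (H z) * (indicator {R z<..} (R z + H z * y)
        * F ((dyck_moments n z)(Suc n := R z + H z * y)))) \<partial>lborel)"
      unfolding jac mom orth ennreal_mult[OF Jpos less_imp_le[OF Hpos]]
      by (intro nn_integral_cong) (simp only: mult_ac)
    also have "\<dots> = ennreal (J z) * (ennreal \<bar>H z\<bar> * (\<integral>\<^sup>+y. indicator {R z<..} (R z + H z * y)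
        * F ((dyck_moments n z)(Suc n := R z + H z * y)) \<partial>lborel))"
      using g by (simp add: nn_integral_cmult abs_of_pos[OF Hpos] del: fun_upd_apply)
    also have "\<dots> = ennreal (J z) * (\<integral>\<^sup>+u. indicator {R z<..} u * F ((dyck_moments n z)(Suc n := u)) \<partial>lborel)"
      using h Hpos by (subst nn_integral_real_affine[where c = "H z" and t = "R z"]) simp_all
    finally show ?thesis unfolding K_def R using True by simp
  qed
  have outer: "(\<integral>\<^sup>+u. indicator (stieltjes_domain (Suc n)) (m(Suc n := u)) * F (m(Suc n := u)) \<partial>lborel)
      = indicator (stieltjes_domain n) m * K m" if m: "m \<in> space (Rn_lebesgue n)" for m
  proof -
    note [measurable] = F_upd[OF m]
    have c: "stieltjes_coords (m(Suc n := u)) n = stieltjes_coords m n" for u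
      by (rule stieltjes_coords_cong) auto
    have "m(Suc n := u) \<in> stieltjes_domain n \<longleftrightarrow> m \<in> stieltjes_domain n" for u
      unfolding stieltjes_domain_def using c by simp
    then have "indicator (stieltjes_domain (Suc n)) (m(Suc n := u))
        = (indicator (stieltjes_domain n) m * indicator {dyck_moment (stieltjes_coords m n) (Suc n)<..} u :: ennreal)" for u
      by (auto simp: stieltjes_domain_Suc c indicator_def)
    then show ?thesis unfolding K_def by (simp add: mult.assoc nn_integral_cmult)
  qed
  have meas1: "(\<lambda>z. indicator (positive_orthant (Suc n)) z * ennreal (\<Prod>i=1..Suc n. z i ^ (Suc n - i))
      * F (dyck_moments (Suc n) z)) \<in> borel_measurable (Rn_lebesgue (Suc n))"
  proof -
    have [measurable]: "(\<lambda>z. \<Prod>i=1..Suc n. z i ^ (Suc n - i)) \<in> borel_measurable (Rn_lebesgue (Suc n))"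
      by (intro borel_measurable_prod borel_measurable_power measurable_Rn_lebesgue_component)
    have [measurable]: "Measurable.pred (Rn_lebesgue (Suc n)) (\<lambda>z. \<forall>i\<in>{1..Suc n}. z i > 0)"
      by (intro pred_intros_finite borel_measurable_less measurable_Rn_lebesgue_component) auto
    note [measurable] = Fdm
    show ?thesis by measurable
  qed
  have meas2: "(\<lambda>m. indicator (stieltjes_domain (Suc n)) m * F m) \<in> borel_measurable (Rn_lebesgue (Suc n))"
  proof -
    have [measurable]: "(\<lambda>m. stieltjes_coords m (Suc n) i) \<in> borel_measurable (Rn_lebesgue (Suc n))" for i
      by (rule measurable_stieltjes_coords) (rule measurable_Rn_lebesgue_component)
    show ?thesis unfolding stieltjes_domain_def by measurable
  qed
  have "(\<integral>\<^sup>+z. indicator (positive_orthant (Suc n)) z * ennreal (\<Prod>i=1..Suc n. z i ^ (Suc n - i))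
        * F (dyck_moments (Suc n) z) \<partial>Rn_lebesgue (Suc n))
      = (\<integral>\<^sup>+z. indicator (positive_orthant n) z * ennreal (J z) * K (dyck_moments n z) \<partial>Rn_lebesgue n)"
    by (rule trans[OF split[OF _ _ meas1] nn_integral_cong[OF inner]]) simp_all
  also have "\<dots> = (\<integral>\<^sup>+m. indicator (stieltjes_domain n) m * K m \<partial>Rn_lebesgue n)"
    unfolding J_def by (rule Suc.IH[OF K])
  also have "\<dots> = (\<integral>\<^sup>+m. indicator (stieltjes_domain (Suc n)) m * F m \<partial>Rn_lebesgue (Suc n))"
    by (rule trans[OF split[OF _ _ meas2] nn_integral_cong[OF outer], symmetric]) simp_all
  finally show ?case .
qed

section \<open>The law of the random moments\<close>

definition gamma_density :: "real \<Rightarrow> real \<Rightarrow> real \<Rightarrow> real" where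
  "gamma_density a d z = indicator {0<..} z * (d powr a / Gamma a * z powr (a - 1) * exp (- d * z))"

lemma measurable_gamma_density [measurable]: "gamma_density a d \<in> borel_measurable borel"
  unfolding gamma_density_def by measurable

lemma gamma_density_nonneg: "a > 0 \<Longrightarrow> gamma_density a d z \<ge> 0"
  by (auto simp: gamma_density_def Gamma_real_nonneg indicator_def intro!: mult_nonneg_nonneg divide_nonneg_nonneg)

text \<open>Euler's integral for the gamma function after the substitution \<open>t = d z\<close>.\<close>

lemma prob_space_gamma_density:
  assumes "a > 0" "d > 0"
  shows "prob_space (density lborel (\<lambda>z. ennreal (gamma_density a d z)))"
proof (rule prob_spaceI)
  define g where "g t = indicator {0..} t * t powr (a - 1) / exp t" for t :: real
  have G: "Gamma a > 0" using assms by (rule_tac Gamma_real_pos)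
  have [measurable]: "g \<in> borel_measurable borel" unfolding g_def by measurable
  have g: "gamma_density a d z = (d / Gamma a) * g (d * z)" for z
  proof (cases "z > 0")
    case True
    have "d powr a = d * d powr (a - 1)" using assms by (simp add: powr_mult_base)
    then show ?thesis using True assms
      by (simp add: gamma_density_def g_def powr_mult exp_minus field_simps)
  next
    case False
    then show ?thesis using assms
      by (auto simp: gamma_density_def g_def indicator_def zero_le_mult_iff)
  qed
  have "ennreal (Gamma a) = (\<integral>\<^sup>+t. ennreal (g t) \<partial>lborel)"
    using Gamma_conv_nn_integral_real[OF assms(1)] by (simp add: g_def)
  also have "\<dots> = ennreal d * (\<integral>\<^sup>+z. ennreal (g (d * z)) \<partial>lborel)"
    using assms by (subst nn_integral_real_affine[where c = d and t = 0]) auto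
  finally have I: "ennreal d * (\<integral>\<^sup>+z. ennreal (g (d * z)) \<partial>lborel) = ennreal (Gamma a)" ..
  have "(\<integral>\<^sup>+z. ennreal (gamma_density a d z) \<partial>lborel)
      = (\<integral>\<^sup>+z. ennreal (1 / Gamma a) * (ennreal d * ennreal (g (d * z))) \<partial>lborel)"
    unfolding g using G assms
    by (intro nn_integral_cong) (simp add: g_def flip: ennreal_mult)
  also have "\<dots> = ennreal (1 / Gamma a) * ennreal (Gamma a)"
    by (simp add: nn_integral_cmult I)
  also have "\<dots> = 1" using G by (simp flip: ennreal_mult)
  finally show "emeasure (density lborel (\<lambda>z. ennreal (gamma_density a d z)))
      (space (density lborel (\<lambda>z. ennreal (gamma_density a d z)))) = 1"
    by (simp add: emeasure_density cong: nn_integral_cong)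
qed

lemma PiM_density_lborel:
  fixes f :: "'i \<Rightarrow> real \<Rightarrow> real"
  assumes I: "finite I" and f[measurable]: "\<And>i. f i \<in> borel_measurable borel"
  shows "Pi\<^sub>M I (\<lambda>i. density lborel (\<lambda>x. ennreal (f i x)))
    = density (Pi\<^sub>M I (\<lambda>_. lborel)) (\<lambda>x. \<Prod>i\<in>I. ennreal (f i (x i)))"
proof -
  interpret L: product_sigma_finite "\<lambda>_::'i. lborel :: real measure" ..
  have "sigma_finite_measure (density lborel (\<lambda>x. ennreal (f i x)))" for i
    by (subst sigma_finite_measure.sigma_finite_iff_density_finite[OF sigma_finite_lborel]) auto
  then interpret D: product_sigma_finite "\<lambda>i. density lborel (\<lambda>x. ennreal (f i x))"
    by (simp add: product_sigma_finite_def)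
  have sets: "sets (density (Pi\<^sub>M I (\<lambda>_. lborel)) (\<lambda>x. \<Prod>i\<in>I. ennreal (f i (x i))))
      = sets (Pi\<^sub>M I (\<lambda>i. density lborel (\<lambda>x. ennreal (f i x))))"
    by (simp cong: sets_PiM_cong)
  have comp: "i \<in> I \<Longrightarrow> (\<lambda>x. f i (x i)) \<in> borel_measurable (Pi\<^sub>M I (\<lambda>_. lborel))" for i
    using measurable_component_singleton[of i I "\<lambda>_. lborel"] by (intro measurable_compose[OF _ f]) simp
  have prod: "(\<lambda>x. \<Prod>i\<in>I. ennreal (f i (x i))) \<in> borel_measurable (Pi\<^sub>M I (\<lambda>_. lborel))"
    using comp by (intro borel_measurable_prod_ennreal measurable_compose[OF _ measurable_ennreal])
  show ?thesis
  proof (rule D.PiM_eqI[OF I sets, symmetric])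
    fix A :: "'i \<Rightarrow> real set"
    assume A: "\<And>i. i \<in> I \<Longrightarrow> A i \<in> sets (density lborel (\<lambda>x. ennreal (f i x)))"
    have "emeasure (density (Pi\<^sub>M I (\<lambda>_. lborel)) (\<lambda>x. \<Prod>i\<in>I. ennreal (f i (x i)))) (Pi\<^sub>E I A)
        = (\<integral>\<^sup>+x. (\<Prod>i\<in>I. ennreal (f i (x i))) * indicator (Pi\<^sub>E I A) x \<partial>Pi\<^sub>M I (\<lambda>_. lborel))"
      using prod A I by (intro emeasure_density) (auto intro!: sets_PiM_I_finite)
    also have "\<dots> = (\<integral>\<^sup>+x. (\<Prod>i\<in>I. ennreal (f i (x i)) * indicator (A i) (x i)) \<partial>Pi\<^sub>M I (\<lambda>_. lborel))"
    proof (intro nn_integral_cong)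
      fix x assume "x \<in> space (Pi\<^sub>M I (\<lambda>_. lborel :: real measure))"
      then have "indicator (Pi\<^sub>E I A) x = (\<Prod>i\<in>I. indicator (A i) (x i) :: ennreal)"
        using I by (auto simp: indicator_def PiE_iff space_PiM prod_zero_iff)
      then show "(\<Prod>i\<in>I. ennreal (f i (x i))) * indicator (Pi\<^sub>E I A) x
          = (\<Prod>i\<in>I. ennreal (f i (x i)) * indicator (A i) (x i))"
        by (simp add: prod.distrib)
    qed
    also have "\<dots> = (\<Prod>i\<in>I. \<integral>\<^sup>+y. ennreal (f i y) * indicator (A i) y \<partial>lborel)"
      using A I by (intro L.product_nn_integral_prod) auto
    also have "\<dots> = (\<Prod>i\<in>I. emeasure (density lborel (\<lambda>x. ennreal (f i x))) (A i))"
      using A by (intro prod.cong refl) (simp add: emeasure_density)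
    finally show "emeasure (density (Pi\<^sub>M I (\<lambda>_. lborel)) (\<lambda>x. \<Prod>i\<in>I. ennreal (f i (x i)))) (Pi\<^sub>E I A)
        = (\<Prod>i\<in>I. emeasure (density lborel (\<lambda>x. ennreal (f i x))) (A i))" .
  qed
qed

lemma prob_space_eqI_le:
  assumes "prob_space M" "prob_space N" "sets M = sets N"
    and le: "\<And>A. A \<in> sets M \<Longrightarrow> emeasure M A \<le> emeasure N A"
  shows "M = N"
proof (rule measure_eqI)
  interpret M: prob_space M by fact
  interpret N: prob_space N by fact
  have space: "space M = space N" using assms(3) by (rule sets_eq_imp_space_eq)
  have le': "M.prob A \<le> N.prob A" if "A \<in> sets M" for A
    using le[OF that] by (simp add: M.emeasure_eq_measure N.emeasure_eq_measure)
  fix A assume A: "A \<in> sets M"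
  have "M.prob A \<ge> N.prob A"
    using le'[of "space M - A"] A assms(3) space M.prob_compl[OF A] N.prob_compl[of A] by auto
  then show "emeasure M A = emeasure N A"
    using le'[OF A] by (simp add: M.emeasure_eq_measure N.emeasure_eq_measure)
qed fact

text \<open>The Jacobian raises the exponent of \<open>z\<^sub>j\<close> from \<open>\<gamma>\<^sub>j\<close> to \<open>\<gamma>\<^sub>j + n - j\<close>, which is what the normalising
factor \<open>\<Gamma>(\<gamma>\<^sub>j + n - j + 1)\<close> requires.\<close>

lemma moment_density_dyck_moments:
  assumes z: "\<And>i. i \<in> {1..n} \<Longrightarrow> z i > 0"
  shows "moment_density \<gamma> \<delta> n (dyck_moments n z) * (\<Prod>i=1..n. z i ^ (n - i))
    = (\<Prod>j=1..n. gamma_density (\<gamma> j + real n - real j + 1) (\<delta> j) (z j))"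
proof -
  let ?m = "dyck_moments n z"
  have zc: "z_coord ?m j = z j" if "j \<in> {1..n}" for j
    by (rule z_coord_dyck) (use that z in \<open>auto simp: dyck_moments_def\<close>)
  have "?m \<in> Rn_topology n interior_of moment_space n"
    by (rule stieltjes_domain_subset_interior[OF _ dyck_moments_in_domain])
      (use z in \<open>auto simp: dyck_moments_def\<close>)
  note ind = indicator_simps(1)[OF this]
  have "moment_density \<gamma> \<delta> n ?m * (\<Prod>i=1..n. z i ^ (n - i))
      = (\<Prod>j=1..n. (\<delta> j powr (\<gamma> j + real n - real j + 1) / Gamma (\<gamma> j + real n - real j + 1)) *
          (z_coord ?m j powr \<gamma> j * exp (- \<delta> j * z_coord ?m j) * indicator {0<..} (z_coord ?m j)) * z j ^ (n - j))"
    by (simp only: moment_density_def prod.distrib ind mult_1_right)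
  also have "\<dots> = (\<Prod>j=1..n. gamma_density (\<gamma> j + real n - real j + 1) (\<delta> j) (z j))"
  proof (intro prod.cong refl)
    fix j assume j: "j \<in> {1..n}"
    have "z j powr (\<gamma> j + real n - real j) = z j powr \<gamma> j * z j powr real (n - j)"
      using j by (simp add: powr_add[symmetric] of_nat_diff add_diff_eq)
    also have "\<dots> = z j powr \<gamma> j * z j ^ (n - j)"
      using z[OF j] by (simp add: powr_realpow)
    finally show "(\<delta> j powr (\<gamma> j + real n - real j + 1) / Gamma (\<gamma> j + real n - real j + 1)) *
          (z_coord ?m j powr \<gamma> j * exp (- \<delta> j * z_coord ?m j) * indicator {0<..} (z_coord ?m j)) * z j ^ (n - j)
        = gamma_density (\<gamma> j + real n - real j + 1) (\<delta> j) (z j)"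
      using z[OF j] unfolding zc[OF j] gamma_density_def by simp
  qed
  finally show ?thesis .
qed

text \<open>The change of variables shows that the law of the Dyck moments of independent gamma variables is
the restriction of the law of \<open>X\<close> to the open set \<open>stieltjes_domain n\<close>.  Being dominated by a
probability measure and having mass one, it is equal to it.\<close>

lemma random_moments_law:
  assumes \<gamma>: "\<And>j. j \<ge> 1 \<Longrightarrow> \<gamma> j > -1" and \<delta>: "\<And>j. j \<ge> 1 \<Longrightarrow> \<delta> j > 0"
    and \<Omega>: "prob_space \<Omega>"
    and X: "distributed \<Omega> (Rn_lebesgue n) X (\<lambda>m. ennreal (moment_density \<gamma> \<delta> n m))"
  shows "distr \<Omega> (Rn_borel n) X =
    distr (Pi\<^sub>M {1..n} (\<lambda>j. density lborel (\<lambda>z. ennreal (gamma_density (\<gamma> j + real n - real j + 1) (\<delta> j) z))))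
      (Rn_borel n) (dyck_moments n)"
proof -
  define g where "g j = gamma_density (\<gamma> j + real n - real j + 1) (\<delta> j)" for j
  define P where "P = Pi\<^sub>M {1..n} (\<lambda>j. density lborel (\<lambda>z. ennreal (g j z)))"
  have g_meas[measurable]: "g j \<in> borel_measurable borel" for j unfolding g_def by measurable
  have shape: "\<gamma> j + real n - real j + 1 > 0" if "j \<in> {1..n}" for j
    using \<gamma>[of j] that by auto
  have P: "prob_space P"
    unfolding P_def g_def using shape \<delta> by (intro prob_space_PiM prob_space_gamma_density) auto
  have dm: "dyck_moments n \<in> measurable P (Rn_borel n)"
    unfolding P_def by (rule measurable_dyck_moments) simp
  have sets: "sets (Rn_borel n) = sets (Rn_lebesgue n)" by (intro sets_PiM_cong) auto
  have Xm: "X \<in> measurable \<Omega> (Rn_lebesgue n)" using X by (rule distributed_measurable)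
  then have Xb: "X \<in> measurable \<Omega> (Rn_borel n)" using measurable_cong_sets[OF refl sets] by blast
  have dens: "(\<lambda>m. ennreal (moment_density \<gamma> \<delta> n m)) \<in> borel_measurable (Rn_lebesgue n)"
    using X by (rule distributed_borel_measurable)
  have "distr P (Rn_borel n) (dyck_moments n) = distr \<Omega> (Rn_borel n) X"
  proof (rule prob_space_eqI_le)
    show "prob_space (distr P (Rn_borel n) (dyck_moments n))"
      using P dm by (rule prob_space.prob_space_distr)
    show "prob_space (distr \<Omega> (Rn_borel n) X)"
      using \<Omega> Xb by (rule prob_space.prob_space_distr)
    fix A assume "A \<in> sets (distr P (Rn_borel n) (dyck_moments n))"
    then have A: "A \<in> sets (Rn_borel n)" and A': "A \<in> sets (Rn_lebesgue n)" using sets by auto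
    define F where "F m = ennreal (moment_density \<gamma> \<delta> n m) * indicator A m" for m
    have F: "F \<in> borel_measurable (Rn_lebesgue n)"
      unfolding F_def using dens A' by (intro borel_measurable_times_ennreal borel_measurable_indicator)
    have dmL: "dyck_moments n \<in> measurable (Rn_lebesgue n) (Rn_borel n)"
      by (rule measurable_dyck_moments) simp
    have meas_prod: "(\<lambda>z. \<Prod>j=1..n. ennreal (g j (z j))) \<in> borel_measurable (Rn_lebesgue n)"
      by (intro borel_measurable_prod_ennreal measurable_compose[OF _ measurable_ennreal]
        measurable_compose[OF measurable_Rn_lebesgue_component g_meas])
    have "emeasure (distr P (Rn_borel n) (dyck_moments n)) A = (\<integral>\<^sup>+z. indicator A (dyck_moments n z) \<partial>P)"
      using A dm by (subst nn_integral_indicator[symmetric]) (auto simp: nn_integral_distr simp del: nn_integral_indicator)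
    also have "\<dots> = (\<integral>\<^sup>+z. (\<Prod>j=1..n. ennreal (g j (z j))) * indicator A (dyck_moments n z) \<partial>Rn_lebesgue n)"
      unfolding P_def using A dmL meas_prod
      by (subst PiM_density_lborel) (auto simp: nn_integral_density)
    also have "\<dots> = (\<integral>\<^sup>+z. indicator (positive_orthant n) z * ennreal (\<Prod>i=1..n. z i ^ (n - i))
        * F (dyck_moments n z) \<partial>Rn_lebesgue n)"
    proof (rule nn_integral_cong)
      fix z :: "nat \<Rightarrow> real"
      show "(\<Prod>j=1..n. ennreal (g j (z j))) * indicator A (dyck_moments n z)
          = indicator (positive_orthant n) z * ennreal (\<Prod>i=1..n. z i ^ (n - i)) * F (dyck_moments n z)"
      proof (cases "z \<in> positive_orthant n")
        case True
        have "(\<Prod>j=1..n. ennreal (g j (z j))) = ennreal (\<Prod>j=1..n. g j (z j))"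
          using shape by (intro prod_ennreal) (auto simp: g_def intro!: gamma_density_nonneg)
        also have "\<dots> = ennreal (\<Prod>i=1..n. z i ^ (n - i)) * ennreal (moment_density \<gamma> \<delta> n (dyck_moments n z))"
        proof -
          have "(\<Prod>i=1..n. z i ^ (n - i)) \<ge> 0" using True by (intro prod_nonneg) (auto intro: less_imp_le)
          then show ?thesis
            unfolding g_def using moment_density_dyck_moments[of n z \<gamma> \<delta>] True
            by (metis (no_types, lifting) ennreal_mult'' mem_Collect_eq mult.commute)
        qed
        finally show ?thesis using True by (simp add: F_def mult_ac)
      next
        case False
        then obtain i where "i \<in> {1..n}" "\<not> z i > 0" by auto
        then have "(\<Prod>j=1..n. ennreal (g j (z j))) = 0"
          by (intro prod_zero) (auto simp: g_def gamma_density_def intro!: bexI[of _ i])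
        then show ?thesis using False by simp
      qed
    qed
    also have "\<dots> = (\<integral>\<^sup>+m. indicator (stieltjes_domain n) m * F m \<partial>Rn_lebesgue n)"
      by (rule stieltjes_change_of_variables[OF F])
    also have "\<dots> \<le> (\<integral>\<^sup>+m. F m \<partial>Rn_lebesgue n)"
      by (intro nn_integral_mono) (auto simp: indicator_def)
    also have "\<dots> = emeasure (distr \<Omega> (Rn_lebesgue n) X) A"
      unfolding distributed_distr_eq_density[OF X] F_def using dens A' by (subst emeasure_density) auto
    also have "\<dots> = emeasure (distr \<Omega> (Rn_borel n) X) A"
      using A A' Xm Xb by (simp add: emeasure_distr)
    finally show "emeasure (distr P (Rn_borel n) (dyck_moments n)) A \<le> emeasure (distr \<Omega> (Rn_borel n) X) A" .
  qed simp
  then show ?thesis unfolding P_def g_def ..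
qed

section \<open>Normal limit of independent gamma variables\<close>

text \<open>A common upper bound for positive and negative \<open>s\<close>: it behaves like \<open>s - s\<^sup>2 / 2\<close> near 0, and the
correction still grows linearly for large \<open>s\<close>.\<close>

lemma ln_one_plus_le_quadratic:
  fixes s :: real
  assumes "s > -1"
  shows "ln (1 + s) \<le> s - s\<^sup>2 / (2 * (1 + \<bar>s\<bar>))"
proof (cases "s \<ge> 0")
  case True
  define \<phi> where "\<phi> t = t - t\<^sup>2 / (2 * (1 + t)) - ln (1 + t)" for t :: real
  have "\<phi> 0 \<le> \<phi> s"
  proof (rule DERIV_nonneg_imp_nondecreasing[OF True])
    fix t :: real assume "0 \<le> t" "t \<le> s"
    then have nz: "1 + t \<noteq> 0" "1 + t > 0" by auto
    have "(\<phi> has_real_derivative 1 - (2 * t * (2 * (1 + t)) - t\<^sup>2 * 2) / (2 * (1 + t))\<^sup>2 - 1 / (1 + t)) (at t)"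
      unfolding \<phi>_def using nz by (auto intro!: derivative_eq_intros simp: power2_eq_square)
    also have "1 - (2 * t * (2 * (1 + t)) - t\<^sup>2 * 2) / (2 * (1 + t))\<^sup>2 - 1 / (1 + t) = t\<^sup>2 / (2 * (1 + t)\<^sup>2)"
      using nz by (simp add: divide_simps power2_eq_square) (simp add: algebra_simps)
    finally have "(\<phi> has_real_derivative t\<^sup>2 / (2 * (1 + t)\<^sup>2)) (at t)" .
    moreover have "t\<^sup>2 / (2 * (1 + t)\<^sup>2) \<ge> 0" by simp
    ultimately show "\<exists>y. (\<phi> has_real_derivative y) (at t) \<and> 0 \<le> y" by blast
  qed
  then show ?thesis using True by (simp add: \<phi>_def)
next
  case False
  define \<psi> where "\<psi> t = t - t\<^sup>2 / 2 - ln (1 + t)" for t :: real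
  have "\<psi> 0 \<le> \<psi> s"
  proof (rule DERIV_nonpos_imp_nonincreasing[of s 0])
    fix t :: real assume t: "s \<le> t" "t \<le> 0"
    then have "(\<psi> has_real_derivative - (t\<^sup>2 / (1 + t))) (at t)"
      unfolding \<psi>_def using assms
      by (auto intro!: derivative_eq_intros simp: field_simps power2_eq_square)
    moreover have "- (t\<^sup>2 / (1 + t)) \<le> 0" using t assms by simp
    ultimately show "\<exists>y. (\<psi> has_real_derivative y) (at t) \<and> y \<le> 0" by blast
  qed (use False in simp)
  then have "ln (1 + s) \<le> s - s\<^sup>2 / 2" by (simp add: \<psi>_def)
  also have "\<dots> \<le> s - s\<^sup>2 / (2 * (1 + \<bar>s\<bar>))"
    by (intro diff_left_mono divide_left_mono) auto
  finally show ?thesis .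
qed

text \<open>The density of \<open>sqrt n (Z - 1)\<close>, for \<open>Z\<close> gamma distributed with shape \<open>n + c + 1\<close> and rate \<open>n\<close>, up
to the factor \<open>gamma_constant c n\<close>, which the condition of total mass one determines.\<close>

definition scaled_gamma :: "real \<Rightarrow> nat \<Rightarrow> real \<Rightarrow> real" where
  "scaled_gamma c n x = indicator {- sqrt n<..} x * ((1 + x / sqrt n) powr (n + c) * exp (- sqrt n * x))"

lemma measurable_scaled_gamma [measurable]: "scaled_gamma c n \<in> borel_measurable borel"
  unfolding scaled_gamma_def by measurable

lemma scaled_gamma_nonneg: "scaled_gamma c n x \<ge> 0"
  by (simp add: scaled_gamma_def)

text \<open>An integrable bound that does not depend on \<open>n\<close> or \<open>c\<close>.  For \<open>n\<close> large compared with \<open>c\<close>, the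
quadratic part of the logarithm contributes at most \<open>(1 - \<bar>x\<bar>) / 4\<close> and the part that is linear in
\<open>c\<close> at most \<open>\<bar>x\<bar> / 8\<close>.\<close>

lemma scaled_gamma_le:
  assumes n: "n \<ge> 1" and c: "8 * \<bar>c\<bar> \<le> sqrt n"
  shows "scaled_gamma c n x \<le> exp (1/4 - \<bar>x\<bar> / 8)"
proof (cases "x > - sqrt n")
  case True
  define s where "s = x / sqrt n"
  have rt: "sqrt n \<ge> 1" "sqrt n * sqrt n = n" using n by auto
  have s: "s > -1" using True rt by (simp add: s_def field_simps)
  have sx: "\<bar>s\<bar> \<le> \<bar>x\<bar>" unfolding s_def using rt by (simp add: field_simps mult_le_cancel_left1)
  have ns: "n * s = sqrt n * x" "n * s\<^sup>2 = x\<^sup>2"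
    using rt n by (simp_all add: s_def field_simps power2_eq_square)
  have "8 * \<bar>c\<bar> \<le> n"
    using c rt by (metis mult_left_mono mult.right_neutral order_trans order.trans zero_le_one)
  then have half: "n + c \<ge> n / 2" by linarith
  have lin: "c * s \<le> \<bar>x\<bar> / 8"
  proof -
    have "c * s \<le> \<bar>c\<bar> * \<bar>s\<bar>" by (metis abs_ge_self abs_mult)
    also have "\<dots> = \<bar>c\<bar> / sqrt n * \<bar>x\<bar>" by (simp add: s_def)
    also have "\<dots> \<le> 1 / 8 * \<bar>x\<bar>" using c rt by (intro mult_right_mono) (auto simp: field_simps)
    finally show ?thesis by simp
  qed
  have quad: "\<bar>x\<bar> - 1 \<le> x\<^sup>2 / (1 + \<bar>s\<bar>)"
  proof -
    have "(\<bar>x\<bar> - 1) * (1 + \<bar>x\<bar>) \<le> x\<^sup>2" by (simp add: algebra_simps power2_eq_square)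
    then have "\<bar>x\<bar> - 1 \<le> x\<^sup>2 / (1 + \<bar>x\<bar>)" by (simp add: pos_le_divide_eq)
    also have "\<dots> \<le> x\<^sup>2 / (1 + \<bar>s\<bar>)" using sx by (intro divide_left_mono) auto
    finally show ?thesis .
  qed
  have "(n + c) * ln (1 + s) \<le> (n + c) * (s - s\<^sup>2 / (2 * (1 + \<bar>s\<bar>)))"
    using half n by (intro mult_left_mono ln_one_plus_le_quadratic s) auto
  also have "\<dots> = n * s + c * s - (n + c) * (s\<^sup>2 / (2 * (1 + \<bar>s\<bar>)))"
    by (simp add: algebra_simps)
  also have "\<dots> \<le> n * s + c * s - n / 2 * (s\<^sup>2 / (2 * (1 + \<bar>s\<bar>)))"
    using half by (intro diff_left_mono mult_right_mono) auto
  also have "n / 2 * (s\<^sup>2 / (2 * (1 + \<bar>s\<bar>))) = (x\<^sup>2 / (1 + \<bar>s\<bar>)) / 4"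
    by (simp add: ns(2)[symmetric])
  finally have upper: "(n + c) * ln (1 + s) \<le> n * s + c * s - (x\<^sup>2 / (1 + \<bar>s\<bar>)) / 4" .
  have "a - b \<le> 1 / 4 - \<bar>x\<bar> / 8" if "a \<le> b + d - q / 4" "d \<le> \<bar>x\<bar> / 8" "\<bar>x\<bar> - 1 \<le> q" for a b d q :: real
    using that by linarith
  from this[OF upper lin quad] have "(n + c) * ln (1 + s) - sqrt n * x \<le> 1 / 4 - \<bar>x\<bar> / 8"
    unfolding ns(1) .
  moreover have "scaled_gamma c n x = exp ((n + c) * ln (1 + s) - sqrt n * x)"
    using True s by (simp add: scaled_gamma_def powr_def s_def exp_diff exp_minus field_simps)
  ultimately show ?thesis by simp
qed (simp add: scaled_gamma_def)

lemma scaled_gamma_tendsto: "(\<lambda>n. scaled_gamma c n x) \<longlonglongrightarrow> exp (- x\<^sup>2 / 2)"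
proof -
  have "(\<lambda>n. (1 + x / sqrt (real n)) powr (real n + c) * exp (- sqrt (real n) * x)) \<longlonglongrightarrow> exp (- x\<^sup>2 / 2)"
  proof (cases "x = 0")
    case False
    then consider "x > 0" | "x < 0" by linarith
    then show ?thesis by cases (real_asymp simp: power2_eq_square)+
  qed simp
  moreover have "eventually (\<lambda>n. x > - sqrt (real n)) sequentially" by real_asymp
  then have "eventually (\<lambda>n. (1 + x / sqrt (real n)) powr (real n + c) * exp (- sqrt (real n) * x) = scaled_gamma c n x) sequentially"
    by eventually_elim (simp add: scaled_gamma_def)
  ultimately show ?thesis by (rule Lim_transform_eventually)
qed

lemma integrable_exp_minus_abs:
  assumes "l > 0"
  shows "integrable lborel (\<lambda>x::real. exp (- l * \<bar>x\<bar>))"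
proof -
  have 1: "integrable lborel (exponential_density l)"
  proof (rule integrableI_nonneg)
    interpret prob_space "density lborel (exponential_density l)"
      by (rule prob_space_exponential_density[OF assms])
    show "(\<integral>\<^sup>+x. ennreal (exponential_density l x) \<partial>lborel) < \<infinity>"
      using emeasure_space_1 by (simp add: emeasure_density cong: nn_integral_cong)
  qed (use assms exponential_density_nonneg in auto)
  then have 2: "integrable lborel (\<lambda>x. exponential_density l (0 + (-1) * x))"
    by (rule lborel_integrable_real_affine) simp
  have "integrable lborel (\<lambda>x. (exponential_density l x + exponential_density l (0 + (-1) * x)) / l)"
    using 1 2 by auto
  then show ?thesis
    by (rule Bochner_Integration.integrable_bound)
      (use assms in \<open>auto simp: exponential_density_def erlang_density_def abs_if mult_ac\<close>)
qed

definition gamma_constant :: "real \<Rightarrow> nat \<Rightarrow> real" where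
  "gamma_constant c n = n powr (n + c + 1) / Gamma (n + c + 1) * exp (- n) / sqrt n"

lemma gamma_density_standardised:
  assumes n: "n \<ge> 1"
  shows "gamma_density (n + c + 1) n (1 + x / sqrt n) / sqrt n = gamma_constant c n * scaled_gamma c n x"
proof -
  have rt: "sqrt n > 0" "real n = sqrt n * sqrt n" using n by auto
  have "real n * (1 + x / sqrt n) = n + sqrt n * x" using rt by (simp add: field_simps)
  then have e: "exp (- n * (1 + x / sqrt n)) = exp (- n) * exp (- sqrt n * x)"
    by (simp add: exp_add[symmetric])
  have i: "indicator {0<..} (1 + x / sqrt n) = (indicator {- sqrt n<..} x :: real)"
    using rt by (auto simp: indicator_def field_simps)
  show ?thesis
    unfolding gamma_density_def gamma_constant_def scaled_gamma_def i using e by simp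
qed

lemma gamma_density_as_distr:
  assumes n: "n \<ge> 1"
  shows "density lborel (\<lambda>z. ennreal (gamma_density (n + c + 1) n z))
    = distr (density lborel (\<lambda>x. ennreal (gamma_constant c n * scaled_gamma c n x))) borel (\<lambda>x. 1 + x / sqrt n)"
proof (rule measure_eqI)
  have rt: "sqrt n > 0" using n by simp
  fix A assume "A \<in> sets (density lborel (\<lambda>z. ennreal (gamma_density (n + c + 1) n z)))"
  then have [measurable]: "A \<in> sets borel" by simp
  have "emeasure (density lborel (\<lambda>z. ennreal (gamma_density (n + c + 1) n z))) A
      = (\<integral>\<^sup>+z. ennreal (gamma_density (n + c + 1) n z) * indicator A z \<partial>lborel)"
    by (rule emeasure_density) auto
  also have "\<dots> = ennreal (1 / sqrt n) *
      (\<integral>\<^sup>+x. ennreal (gamma_density (n + c + 1) n (1 + 1 / sqrt n * x)) * indicator A (1 + 1 / sqrt n * x) \<partial>lborel)"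
    using rt by (subst nn_integral_real_affine[where c = "1 / sqrt n" and t = 1]) auto
  also have "\<dots> = (\<integral>\<^sup>+x. ennreal (1 / sqrt n) *
      (ennreal (gamma_density (n + c + 1) n (1 + 1 / sqrt n * x)) * indicator A (1 + 1 / sqrt n * x)) \<partial>lborel)"
    by (rule nn_integral_cmult[symmetric]) measurable
  also have "\<dots> = (\<integral>\<^sup>+x. ennreal (gamma_constant c n * scaled_gamma c n x) * indicator A (1 + x / sqrt n) \<partial>lborel)"
  proof (rule nn_integral_cong)
    fix x :: real
    show "ennreal (1 / sqrt n) * (ennreal (gamma_density (n + c + 1) n (1 + 1 / sqrt n * x)) * indicator A (1 + 1 / sqrt n * x))
        = ennreal (gamma_constant c n * scaled_gamma c n x) * indicator A (1 + x / sqrt n)"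
      unfolding gamma_density_standardised[OF n, symmetric] using rt
      by (simp add: mult.assoc[symmetric] flip: ennreal_mult')
  qed
  also have "\<dots> = (\<integral>\<^sup>+x. indicator A (1 + x / sqrt n)
      \<partial>density lborel (\<lambda>x. ennreal (gamma_constant c n * scaled_gamma c n x)))"
    by (subst nn_integral_density) auto
  also have "\<dots> = (\<integral>\<^sup>+y. indicator A y
      \<partial>distr (density lborel (\<lambda>x. ennreal (gamma_constant c n * scaled_gamma c n x))) borel (\<lambda>x. 1 + x / sqrt n))"
    by (subst nn_integral_distr) auto
  also have "\<dots> = emeasure (distr (density lborel (\<lambda>x. ennreal (gamma_constant c n * scaled_gamma c n x))) borel (\<lambda>x. 1 + x / sqrt n)) A"
    by (rule nn_integral_indicator) simp
  finally show "emeasure (density lborel (\<lambda>z. ennreal (gamma_density (n + c + 1) n z))) A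
      = emeasure (distr (density lborel (\<lambda>x. ennreal (gamma_constant c n * scaled_gamma c n x))) borel (\<lambda>x. 1 + x / sqrt n)) A" .
qed simp

text \<open>The product of the constants \<open>K j\<close> is determined by the integral of the constant function 1.\<close>

lemma expectation_unnormalised_density:
  fixes f :: "('i \<Rightarrow> real) \<Rightarrow> real"
  assumes I: "finite I" and u[measurable]: "\<And>j. u j \<in> borel_measurable borel"
    and K: "\<And>j x. j \<in> I \<Longrightarrow> 0 \<le> K j * u j x"
    and prob: "\<And>j. j \<in> I \<Longrightarrow> prob_space (density lborel (\<lambda>x. ennreal (K j * u j x)))"
    and f: "f \<in> borel_measurable (Pi\<^sub>M I (\<lambda>_. lborel))"
  shows "(\<integral>x. f x \<partial>Pi\<^sub>M I (\<lambda>j. density lborel (\<lambda>x. ennreal (K j * u j x))))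
     = (\<integral>x. f x * (\<Prod>j\<in>I. u j (x j)) \<partial>Pi\<^sub>M I (\<lambda>_. lborel)) / (\<integral>x. (\<Prod>j\<in>I. u j (x j)) \<partial>Pi\<^sub>M I (\<lambda>_. lborel))"
proof -
  let ?P = "Pi\<^sub>M I (\<lambda>j. density lborel (\<lambda>x. ennreal (K j * u j x)))"
  let ?L = "Pi\<^sub>M I (\<lambda>_. lborel :: real measure)"
  have comp: "i \<in> I \<Longrightarrow> (\<lambda>x. x i) \<in> borel_measurable ?L" for i
    using measurable_component_singleton[of i I "\<lambda>_. lborel"] by simp
  have dens: "?P = density ?L (\<lambda>x. ennreal (\<Prod>j\<in>I. K j * u j (x j)))"
    using PiM_density_lborel[OF I, of "\<lambda>j x. K j * u j x"] K by (simp add: prod_ennreal)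
  have meas: "(\<lambda>x. \<Prod>j\<in>I. K j * u j (x j)) \<in> borel_measurable ?L"
    by (intro borel_measurable_prod borel_measurable_times measurable_compose[OF comp u] borel_measurable_const)
  have int: "(\<integral>x. g x \<partial>?P) = (\<Prod>j\<in>I. K j) * (\<integral>x. g x * (\<Prod>j\<in>I. u j (x j)) \<partial>?L)"
    if g: "g \<in> borel_measurable ?L" for g
  proof -
    have "(\<integral>x. g x \<partial>?P) = (\<integral>x. (\<Prod>j\<in>I. K j * u j (x j)) * g x \<partial>?L)"
      unfolding dens using g meas K by (subst integral_density) (auto intro!: AE_I2 prod_nonneg)
    also have "\<dots> = (\<integral>x. (\<Prod>j\<in>I. K j) * (g x * (\<Prod>j\<in>I. u j (x j))) \<partial>?L)"
      by (simp add: prod.distrib mult_ac)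
    finally show ?thesis by simp
  qed
  interpret P: prob_space ?P using prob by (rule prob_space_PiM)
  have "(1::real) = (\<integral>x. 1 \<partial>?P)" using P.prob_space by simp
  also have "\<dots> = (\<Prod>j\<in>I. K j) * (\<integral>x. (\<Prod>j\<in>I. u j (x j)) \<partial>?L)"
    by (subst int) auto
  finally have 1: "(\<Prod>j\<in>I. K j) * (\<integral>x. (\<Prod>j\<in>I. u j (x j)) \<partial>?L) = 1" ..
  then have "(\<Prod>j\<in>I. K j) = 1 / (\<integral>x. (\<Prod>j\<in>I. u j (x j)) \<partial>?L)"
    by (metis mult_zero_right nonzero_mult_div_cancel_right zero_neq_one)
  then show ?thesis by (simp add: int[OF f])
qed

lemma scaled_gamma_product_limit:
  fixes c :: "nat \<Rightarrow> real" and F :: "nat \<Rightarrow> (nat \<Rightarrow> real) \<Rightarrow> real"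
  assumes F: "\<And>n. F n \<in> borel_measurable (Rn_lebesgue k)" and G: "G \<in> borel_measurable (Rn_lebesgue k)"
    and bound: "\<And>n x. x \<in> space (Rn_lebesgue k) \<Longrightarrow> \<bar>F n x\<bar> \<le> B"
    and lim: "\<And>x. x \<in> space (Rn_lebesgue k) \<Longrightarrow> (\<lambda>n. F n x) \<longlonglongrightarrow> G x"
  shows "(\<lambda>n. \<integral>x. F n x * (\<Prod>j=1..k. scaled_gamma (c j) n (x j)) \<partial>Rn_lebesgue k)
    \<longlonglongrightarrow> (\<integral>x. G x * (\<Prod>j=1..k. exp (- (x j)\<^sup>2 / 2)) \<partial>Rn_lebesgue k)"
proof -
  have "eventually (\<lambda>n. 8 * \<bar>c j\<bar> \<le> sqrt (real n)) sequentially" for j by real_asymp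
  then have "eventually (\<lambda>n. \<forall>j\<in>{1..k}. 8 * \<bar>c j\<bar> \<le> sqrt (real n)) sequentially"
    by (intro eventually_ball_finite) auto
  then obtain N where N: "\<And>n j. n \<ge> N \<Longrightarrow> j \<in> {1..k} \<Longrightarrow> 8 * \<bar>c j\<bar> \<le> sqrt (real n)"
    unfolding eventually_sequentially by blast
  let ?s = "\<lambda>n x. F n x * (\<Prod>j=1..k. scaled_gamma (c j) n (x j))"
  let ?w = "\<lambda>x. \<bar>B\<bar> * (\<Prod>j=1..k. exp (1/4) * exp (- (1/8) * \<bar>x j\<bar>) :: real)"
  \<comment> \<open>The bound on the integrands holds from \<open>N\<close> on, and only for positive \<open>n\<close>; hence the shift by
    \<open>Suc N\<close>.\<close>
  have "(\<lambda>n. \<integral>x. ?s (n + Suc N) x \<partial>Rn_lebesgue k)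
    \<longlonglongrightarrow> (\<integral>x. G x * (\<Prod>j=1..k. exp (- (x j)\<^sup>2 / 2)) \<partial>Rn_lebesgue k)"
  proof (rule integral_dominated_convergence[where w = ?w])
    show "(\<lambda>x. G x * (\<Prod>j=1..k. exp (- (x j)\<^sup>2 / 2))) \<in> borel_measurable (Rn_lebesgue k)"
      by (intro borel_measurable_times G borel_measurable_prod borel_measurable_exp
        measurable_compose[OF measurable_Rn_lebesgue_component, where g = "\<lambda>t. exp (- t\<^sup>2 / 2)"]) simp_all
    show "?s (n + Suc N) \<in> borel_measurable (Rn_lebesgue k)" for n
      by (intro borel_measurable_times F borel_measurable_prod
        measurable_compose[OF measurable_Rn_lebesgue_component measurable_scaled_gamma])
    have "integrable lborel (\<lambda>x::real. exp (1/4) * exp (- (1/8) * \<bar>x\<bar>))"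
      by (intro integrable_mult_right integrable_exp_minus_abs) simp
    then have "integrable (Rn_lebesgue k) (\<lambda>x. \<Prod>j=1..k. exp (1/4) * exp (- (1/8) * \<bar>x j\<bar>))"
      by (intro lborels.product_integrable_prod) auto
    then show "integrable (Rn_lebesgue k) ?w" by (rule integrable_mult_right)
    show "AE x in Rn_lebesgue k. (\<lambda>n. ?s (n + Suc N) x) \<longlonglongrightarrow> G x * (\<Prod>j=1..k. exp (- (x j)\<^sup>2 / 2))"
      by (intro AE_I2 tendsto_mult tendsto_prod LIMSEQ_ignore_initial_segment lim scaled_gamma_tendsto)
    show "AE x in Rn_lebesgue k. norm (?s (n + Suc N) x) \<le> ?w x" for n
    proof (rule AE_I2)
      fix x assume x: "x \<in> space (Rn_lebesgue k)"
      have "\<bar>\<Prod>j=1..k. scaled_gamma (c j) (n + Suc N) (x j)\<bar> \<le> (\<Prod>j=1..k. exp (1/4) * exp (- (1/8) * \<bar>x j\<bar>))"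
        unfolding abs_prod
      proof (intro prod_mono conjI)
        fix j assume j: "j \<in> {1..k}"
        have "scaled_gamma (c j) (n + Suc N) (x j) \<le> exp (1/4 - \<bar>x j\<bar> / 8)"
          by (rule scaled_gamma_le) (use N[OF _ j, of "n + Suc N"] in auto)
        then show "\<bar>scaled_gamma (c j) (n + Suc N) (x j)\<bar> \<le> exp (1/4) * exp (- (1/8) * \<bar>x j\<bar>)"
          using scaled_gamma_nonneg[of "c j" "n + Suc N" "x j"] by (simp flip: exp_add)
      qed simp
      moreover have "\<bar>F (n + Suc N) x\<bar> \<le> \<bar>B\<bar>" using bound[OF x, of "n + Suc N"] by linarith
      ultimately show "norm (?s (n + Suc N) x) \<le> ?w x"
        unfolding real_norm_def abs_mult by (intro mult_mono) auto
    qed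
  qed
  then show ?thesis by (rule LIMSEQ_offset)
qed

text \<open>Both sides are quotients of integrals against unnormalised densities, and numerators and
denominators converge separately.  Allowing integrands \<open>F n\<close> that depend on \<open>n\<close> includes the
delta method: nonlinear functions of the gamma variables need only converge pointwise after
rescaling.\<close>

lemma gamma_product_clt:
  fixes c :: "nat \<Rightarrow> real" and F :: "nat \<Rightarrow> (nat \<Rightarrow> real) \<Rightarrow> real"
  assumes F: "\<And>n. F n \<in> borel_measurable (Rn_lebesgue k)" and G: "G \<in> borel_measurable (Rn_lebesgue k)"
    and bound: "\<And>n x. x \<in> space (Rn_lebesgue k) \<Longrightarrow> \<bar>F n x\<bar> \<le> B"
    and lim: "\<And>x. x \<in> space (Rn_lebesgue k) \<Longrightarrow> (\<lambda>n. F n x) \<longlonglongrightarrow> G x"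
    and shape: "\<And>n j. n \<ge> k \<Longrightarrow> j \<in> {1..k} \<Longrightarrow> real n + c j + 1 > 0"
  shows "(\<lambda>n. \<integral>x. F n x \<partial>Pi\<^sub>M {1..k} (\<lambda>j. density lborel (\<lambda>x. ennreal (gamma_constant (c j) n * scaled_gamma (c j) n x))))
    \<longlonglongrightarrow> (\<integral>x. G x \<partial>std_normal_Rn k)"
proof -
  let ?E = "\<lambda>x. \<Prod>j=1..k. exp (- (x j)\<^sup>2 / 2) :: real"
  let ?U = "\<lambda>n x. \<Prod>j=1..k. scaled_gamma (c j) n (x j)"
  have normal: "(\<integral>x. g x \<partial>std_normal_Rn k) = (\<integral>x. g x * ?E x \<partial>Rn_lebesgue k) / (\<integral>x. ?E x \<partial>Rn_lebesgue k)"
    if "g \<in> borel_measurable (Rn_lebesgue k)" for g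
  proof -
    have "std_normal_density x = 1 / sqrt (2 * pi) * exp (- x\<^sup>2 / 2)" for x
      by (simp add: std_normal_density_def)
    moreover have "prob_space (density lborel (\<lambda>x. ennreal (std_normal_density x)))"
      by (rule prob_space_normal_density) simp
    ultimately show ?thesis
      unfolding std_normal_Rn_def using that
      by (simp only:) (rule expectation_unnormalised_density, auto)
  qed
  have nz: "(\<integral>x. ?E x \<partial>Rn_lebesgue k) \<noteq> 0"
  proof
    \<comment> \<open>A vanishing denominator would make the quotient for the constant function 0 instead of 1.\<close>
    assume 0: "(\<integral>x. ?E x \<partial>Rn_lebesgue k) = 0"
    interpret N: prob_space "std_normal_Rn k"
      unfolding std_normal_Rn_def by (intro prob_space_PiM prob_space_normal_density) simp
    show False using normal[of "\<lambda>_. 1"] 0 N.prob_space by simp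
  qed
  have num: "(\<lambda>n. \<integral>x. F n x * ?U n x \<partial>Rn_lebesgue k) \<longlonglongrightarrow> (\<integral>x. G x * ?E x \<partial>Rn_lebesgue k)"
    by (rule scaled_gamma_product_limit[OF F G bound lim])
  have "(\<lambda>n. \<integral>x. 1 * ?U n x \<partial>Rn_lebesgue k) \<longlonglongrightarrow> (\<integral>x. 1 * ?E x \<partial>Rn_lebesgue k)"
    by (rule scaled_gamma_product_limit[where B = 1]) auto
  then have den: "(\<lambda>n. \<integral>x. ?U n x \<partial>Rn_lebesgue k) \<longlonglongrightarrow> (\<integral>x. ?E x \<partial>Rn_lebesgue k)"
    by simp
  have "(\<integral>x. F n x * ?U n x \<partial>Rn_lebesgue k) / (\<integral>x. ?U n x \<partial>Rn_lebesgue k)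
      = (\<integral>x. F n x \<partial>Pi\<^sub>M {1..k} (\<lambda>j. density lborel (\<lambda>x. ennreal (gamma_constant (c j) n * scaled_gamma (c j) n x))))"
    if n: "n \<ge> Suc k" for n
  proof (rule expectation_unnormalised_density[symmetric])
    fix j assume j: "j \<in> {1..k}"
    have pos: "real n + c j + 1 > 0" using shape[OF _ j, of n] n by simp
    show "0 \<le> gamma_constant (c j) n * scaled_gamma (c j) n x" for x
      using pos by (intro mult_nonneg_nonneg scaled_gamma_nonneg) (simp add: gamma_constant_def Gamma_real_nonneg)
    have "prob_space (density lborel (\<lambda>z. ennreal (gamma_density (n + c j + 1) n z)))"
      using pos n by (intro prob_space_gamma_density) auto
    then show "prob_space (density lborel (\<lambda>x. ennreal (gamma_constant (c j) n * scaled_gamma (c j) n x)))"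
      using n by (subst (asm) gamma_density_as_distr) (auto elim!: prob_space_distrD[rotated])
  qed (use F in auto)
  then have "eventually (\<lambda>n. (\<integral>x. F n x * ?U n x \<partial>Rn_lebesgue k) / (\<integral>x. ?U n x \<partial>Rn_lebesgue k)
      = (\<integral>x. F n x \<partial>Pi\<^sub>M {1..k} (\<lambda>j. density lborel (\<lambda>x. ennreal (gamma_constant (c j) n * scaled_gamma (c j) n x))))) sequentially"
    unfolding eventually_sequentially by blast
  then show ?thesis
    unfolding normal[OF G] by (rule Lim_transform_eventually[OF tendsto_divide[OF num den nz]])
qed

section \<open>Moments of the Marchenko--Pastur distribution and the matrix C\<close>

lemma catalan_Suc: "catalan (Suc j) = catalan j * (2 * (2 * real j + 1) / (real j + 2))"
proof -
  have fct: "catalan j = fact (2 * j) / (fact j * fact (Suc j))" for j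
    by (simp add: catalan_def binomial_fact field_simps)
  have "fact (2 * Suc j) = (2 * real j + 2) * (2 * real j + 1) * fact (2 * j)"
    by (simp add: algebra_simps)
  then show ?thesis unfolding fct by (simp add: divide_simps) (simp add: algebra_simps)
qed

lemma Gamma_plus1_pos: "x > 0 \<Longrightarrow> Gamma (x + 1 :: real) = x * Gamma x"
  by (rule Gamma_plus1) (auto elim!: nonpos_Ints_cases)

text \<open>Both sides satisfy the same first-order recursion, by the functional equation of the gamma function.\<close>

lemma catalan_Beta: "4 ^ Suc j / (2 * pi) * Beta (real j + 1/2) (3/2) = catalan j"
proof (induction j)
  case 0
  have "Gamma (3/2 :: real) = sqrt pi / 2"
    using Gamma_plus1_pos[of "1/2"] by (simp add: Gamma_one_half_real)
  then show ?case
    by (simp add: Beta_def catalan_def Gamma_one_half_real Gamma_numeral field_simps)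
next
  case (Suc j)
  have "Gamma (real (Suc j) + 1/2) = (real j + 1/2) * Gamma (real j + 1/2)"
    using Gamma_plus1_pos[of "real j + 1/2"] by (simp add: add_ac)
  moreover have "Gamma (real (Suc j) + 1/2 + 3/2) = (real j + 2) * Gamma (real j + 1/2 + 3/2)"
    using Gamma_plus1_pos[of "real j + 2"] by (simp add: add_ac)
  ultimately have "Beta (real (Suc j) + 1/2) (3/2) = (real j + 1/2) / (real j + 2) * Beta (real j + 1/2) (3/2)"
    by (simp add: Beta_def)
  then have X: "Beta (real (Suc j) + 1/2) (3/2) = (real j + 1/2) / (real j + 2) * Beta (real j + 1/2) (3/2)" .
  have pull: "4 * a / p * X = 4 * r * (a / p * Y)" if "X = r * Y" for a p r X Y :: real
    using that by simp
  have "4 ^ Suc (Suc j) / (2 * pi) * Beta (real (Suc j) + 1/2) (3/2)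
      = 4 * ((real j + 1/2) / (real j + 2)) * catalan j"
    unfolding power_Suc[of 4 "Suc j"] Suc.IH[symmetric] by (rule pull[OF X])
  also have "\<dots> = catalan (Suc j)"
    unfolding catalan_Suc by (simp add: field_simps)
  finally show ?case .
qed

text \<open>The substitution \<open>x = 4 t\<close> turns the moment integral into a beta integral.\<close>

lemma moment_marchenko_pastur: "moment marchenko_pastur j = catalan j"
proof -
  define g where "g x = sqrt (x * (4 - x)) / (2 * pi * x) * indicator {0<..<4} x" for x :: real
  define b where "b t = t powr (real j + 1/2 - 1) * (1 - t) powr (3/2 - 1)" for t :: real
  have [measurable]: "g \<in> borel_measurable borel" unfolding g_def by measurable
  have [measurable]: "b \<in> borel_measurable borel" unfolding b_def by measurable
  have g: "g x \<ge> 0" for x by (auto simp: g_def indicator_def)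
  have xg: "x ^ j * g x \<ge> 0" for x
    by (auto simp: g_def indicator_def intro!: mult_nonneg_nonneg divide_nonneg_nonneg)
  have scale: "4 * ((4 * t) ^ j * g (4 * t)) = 4 ^ Suc j / (2 * pi) * (indicator {0..1} t * b t)" for t
  proof (cases "0 < t \<and> t < 1")
    case True
    define r q where "r = sqrt t" and "q = sqrt (1 - t)"
    have r: "r > 0" "t = r * r" using True by (simp_all add: r_def)
    have b: "b t = t ^ j / r * q"
    proof -
      have h: "t powr (1/2) = r" using True by (simp add: powr_half_sqrt r_def)
      have "real j + 1/2 - 1 = real j - 1/2" by simp
      then have "t powr (real j + 1/2 - 1) = t ^ j / r"
        using True by (simp only: powr_diff powr_realpow h)
      then show ?thesis using True by (simp add: b_def q_def powr_half_sqrt)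
    qed
    have "4 * t * (4 - 4 * t) = 4\<^sup>2 * (t * (1 - t))" by (simp add: algebra_simps)
    then have "sqrt (4 * t * (4 - 4 * t)) = 4 * (r * q)"
      unfolding r_def q_def by (simp only: real_sqrt_mult real_sqrt_abs abs_numeral)
    then have "g (4 * t) = 4 * (r * q) / (2 * pi * (4 * t))"
      using True by (simp add: g_def)
    also have "\<dots> = q / (2 * pi * r)"
      using r by (simp add: field_simps)
    finally show ?thesis
      using True r(1) by (simp add: b power_mult_distrib)
  next
    case False
    then show ?thesis by (auto simp: g_def b_def indicator_def)
  qed
  have "(\<integral>\<^sup>+t. ennreal (indicator {0..1} t * b t) \<partial>lborel) = ennreal (Beta (real j + 1/2) (3/2))"
  proof (rule nn_integral_has_integral_lebesgue)
    show "(b has_integral Beta (real j + 1/2) (3/2)) {0..1}"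
      unfolding b_def by (rule has_integral_Beta_real) auto
  qed (simp add: b_def)
  note beta = this
  have "(\<integral>\<^sup>+x. ennreal (x ^ j * g x) \<partial>lborel) = ennreal \<bar>4\<bar> * (\<integral>\<^sup>+t. ennreal ((0 + 4 * t) ^ j * g (0 + 4 * t)) \<partial>lborel)"
    by (rule nn_integral_real_affine) auto
  also have "\<dots> = (\<integral>\<^sup>+t. ennreal (4 * ((4 * t) ^ j * g (4 * t))) \<partial>lborel)"
    by (subst nn_integral_cmult[symmetric]) (auto simp: ennreal_mult' intro!: nn_integral_cong)
  also have "\<dots> = (\<integral>\<^sup>+t. ennreal (4 ^ Suc j / (2 * pi)) * ennreal (indicator {0..1} t * b t) \<partial>lborel)"
      proof (rule nn_integral_cong)
    show "ennreal (4 * ((4 * t) ^ j * g (4 * t))) = ennreal (4 ^ Suc j / (2 * pi)) * ennreal (indicator {0..1} t * b t)" for t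
      unfolding scale by (rule ennreal_mult') simp
  qed
  also have "\<dots> = ennreal (4 ^ Suc j / (2 * pi)) * ennreal (Beta (real j + 1/2) (3/2))"
    by (subst nn_integral_cmult) (auto simp: beta)
  also have "\<dots> = ennreal (catalan j)"
    unfolding catalan_Beta[symmetric] by (rule ennreal_mult'[symmetric]) simp
  finally have nn: "(\<integral>\<^sup>+x. ennreal (x ^ j * g x) \<partial>lborel) = ennreal (catalan j)" .
  have "moment marchenko_pastur j = (\<integral>x. g x * x ^ j \<partial>lborel)"
    unfolding moment_def marchenko_pastur_def g_def[symmetric] using g
    by (subst integral_density) auto
  also have "\<dots> = (\<integral>x. x ^ j * g x \<partial>lborel)" by (simp add: mult.commute)
  also have "\<dots> = enn2real (\<integral>\<^sup>+x. ennreal (x ^ j * g x) \<partial>lborel)"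
    using xg by (intro integral_eq_nn_integral) auto
  also have "\<dots> = catalan j" unfolding nn by (simp add: catalan_def)
  finally show ?thesis .
qed

text \<open>The matrix is unitriangular, hence invertible, so the choice in \<open>matrix_inverse\<close> picks an inverse.\<close>

lemma C_matrix_inverse:
  assumes "i \<in> {1..k}" "j \<in> {1..k}"
  shows "(\<Sum>l=1..k. matrix_inverse k C_matrix i l * C_matrix l j) = (if i = j then 1 else 0)"
proof -
  define A where "A = mat k k (\<lambda>(i, j). C_matrix (Suc i) (Suc j))"
  have A: "A \<in> carrier_mat k k" by (simp add: A_def)
  have "det A = prod_list (diag_mat A)"
    by (rule det_lower_triangular[OF _ A]) (auto simp: A_def C_matrix_def)
  also have "diag_mat A = replicate k 1"
    by (rule nth_equalityI) (auto simp: A_def diag_mat_def C_matrix_def)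
  finally have "det A \<noteq> 0" by simp
  then have "A \<in> Units (ring_mat TYPE(real) k ())" by (rule det_non_zero_imp_unit[OF A])
  then obtain B where B: "B \<in> carrier_mat k k" "A * B = 1\<^sub>m k" "B * A = 1\<^sub>m k"
    unfolding Units_def by (auto simp: ring_mat_def)
  \<comment> \<open>Matrix entries are indexed from 0, the sums in the goal from 1.\<close>
  define b where "b i j = B $$ (i - 1, j - 1)" for i j
  have shift: "(\<Sum>l=1..k. h l) = (\<Sum>l<k. h (Suc l))" for h :: "nat \<Rightarrow> real"
    by (simp add: sum.atLeast1_atMost_eq)
  have "(\<Sum>l=1..k. C_matrix i l * b l j) = (if i = j then 1 else 0) \<and>
        (\<Sum>l=1..k. b i l * C_matrix l j) = (if i = j then 1 else 0)"
    if ij: "i \<in> {1..k}" "j \<in> {1..k}" for i j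
  proof -
    have "(A * B) $$ (i - 1, j - 1) = (\<Sum>l<k. C_matrix i (Suc l) * b (Suc l) j)"
      "(B * A) $$ (i - 1, j - 1) = (\<Sum>l<k. b i (Suc l) * C_matrix (Suc l) j)"
      using ij B(1) A by (auto simp: scalar_prod_def A_def b_def atLeast0LessThan intro!: sum.cong)
    moreover have "(1\<^sub>m k :: real mat) $$ (i - 1, j - 1) = (if i = j then 1 else 0)"
      using ij by auto
    ultimately show ?thesis unfolding B(2,3) shift by simp
  qed
  then have "\<exists>B. \<forall>i\<in>{1..k}. \<forall>j\<in>{1..k}.
        (\<Sum>l=1..k. C_matrix i l * B l j) = (if i = j then 1 else 0) \<and>
        (\<Sum>l=1..k. B i l * C_matrix l j) = (if i = j then 1 else 0)" by blast
  from someI_ex[OF this] show ?thesis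
    unfolding matrix_inverse_def[symmetric] using assms by blast
qed

section \<open>The limit theorem\<close>

text \<open>On the full countable product the product \<open>\<sigma>\<close>-algebra is known to be the Borel algebra, so the
function is extended to all sequences by restricting them first.\<close>

lemma borel_measurable_continuous_map_Rn:
  assumes f: "continuous_map (Rn_topology k) euclideanreal f"
  shows "f \<in> borel_measurable (Rn_borel k)"
proof -
  have "continuous_map (product_topology (\<lambda>_. euclideanreal) UNIV) (Rn_topology k) (\<lambda>x. restrict x {1..k})"
    unfolding continuous_map_componentwise
    by (auto simp: extensional_def intro: continuous_map_product_projection)
  from continuous_map_compose[OF this f]
  have "continuous_map (product_topology (\<lambda>_. euclideanreal) UNIV) euclideanreal (\<lambda>x. f (restrict x {1..k}))"
    by (simp only: o_def)
  then have "continuous_on UNIV (\<lambda>x::nat \<Rightarrow> real. f (restrict x {1..k}))"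
    by (simp only: euclidean_product_topology continuous_map_iff_continuous2)
  then have "(\<lambda>x::nat \<Rightarrow> real. f (restrict x {1..k})) \<in> borel_measurable borel"
    by (rule borel_measurable_continuous_onI)
  then have g: "(\<lambda>x::nat \<Rightarrow> real. f (restrict x {1..k})) \<in> borel_measurable (Pi\<^sub>M UNIV (\<lambda>_. borel))"
    using measurable_cong_sets[OF sets_PiM_equal_borel refl] by blast
  have "(\<lambda>x i. if i \<in> {1..k} then x i else undefined) \<in> measurable (Rn_borel k) (Pi\<^sub>M UNIV (\<lambda>_. borel :: real measure))"
  proof (rule measurable_PiM_single')
    fix i :: nat
    show "(\<lambda>x. if i \<in> {1..k} then x i else undefined) \<in> borel_measurable (Rn_borel k)"
    proof (cases "i \<in> {1..k}")
      case True
      then show ?thesis using measurable_component_singleton[OF True, of "\<lambda>_. borel :: real measure"] by simp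
    qed (simp only: if_False borel_measurable_const)
  qed (auto simp: PiE_def extensional_def)
  from measurable_compose[OF this g]
  have meas: "(\<lambda>x. f (restrict (\<lambda>i. if i \<in> {1..k} then x i else undefined) {1..k})) \<in> borel_measurable (Rn_borel k)" .
  have "restrict (\<lambda>i. if i \<in> {1..k} then x i else undefined) {1..k} = x" if "x \<in> space (Rn_borel k)" for x :: "nat \<Rightarrow> real"
    using that by (auto simp: space_PiM PiE_def extensional_def)
  then show ?thesis
    by (intro measurable_cong[THEN iffD1, OF _ meas]) (rule arg_cong[where f = f])
qed

lemma distr_PiM_restrict:
  assumes I: "finite I" "J \<subseteq> I" and prob: "\<And>i. i \<in> I \<Longrightarrow> prob_space (M i)"
  shows "distr (Pi\<^sub>M I M) (Pi\<^sub>M J M) (\<lambda>x. restrict x J) = Pi\<^sub>M J M"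
proof -
  \<comment> \<open>The locale of product probability spaces speaks about all indices; point masses fill up the family
    outside \<open>I\<close>.\<close>
  define M' where "M' i = (if i \<in> I then M i else return (count_space UNIV) undefined)" for i
  have "prob_space (M' i)" for i
    unfolding M'_def using prob by (auto intro: prob_space_return)
  then interpret product_prob_space M' I
    by (simp add: product_prob_space_def product_prob_space_axioms_def product_sigma_finite_def prob_space_imp_sigma_finite)
  have "Pi\<^sub>M I M' = Pi\<^sub>M I M" "Pi\<^sub>M J M' = Pi\<^sub>M J M"
    using I by (auto intro!: PiM_cong simp: M'_def)
  then show ?thesis
    using distr_PiM_restrict_finite[of J] I finite_subset[of J I] by simp
qed

definition rescaled_moments :: "nat \<Rightarrow> nat \<Rightarrow> (nat \<Rightarrow> real) \<Rightarrow> (nat \<Rightarrow> real)" where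
  "rescaled_moments k n m = (\<lambda>i\<in>{1..k}. sqrt (real n) *
     mat_vec k (matrix_inverse k C_matrix) (\<lambda>j. m j - catalan j) i)"

lemma rescaled_moments_cong:
  "(\<And>j. j \<in> {1..k} \<Longrightarrow> m j = m' j) \<Longrightarrow> rescaled_moments k n m = rescaled_moments k n m'"
  unfolding rescaled_moments_def mat_vec_def by (intro restrict_ext) (auto intro!: sum.cong)

lemma measurable_rescaled_moments:
  assumes "\<And>j. j \<in> {1..k} \<Longrightarrow> (\<lambda>x. g x j) \<in> borel_measurable M"
  shows "(\<lambda>x. rescaled_moments k n (g x)) \<in> measurable M (Rn_borel k)"
  unfolding rescaled_moments_def
proof (rule measurable_restrict)
  fix i assume "i \<in> {1..k}"
  then have "mat_vec k (matrix_inverse k C_matrix) v i = (\<Sum>j=1..k. matrix_inverse k C_matrix i j * v j)" for v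
    by (simp add: mat_vec_def)
  then show "(\<lambda>x. sqrt (real n) * mat_vec k (matrix_inverse k C_matrix) (\<lambda>j. g x j - catalan j) i) \<in> borel_measurable M"
    by (simp only:) (intro borel_measurable_times borel_measurable_const borel_measurable_sum borel_measurable_diff assms)
qed

text \<open>The difference quotients of the Dyck moments at the point \<open>z = 1\<close> in direction \<open>x\<close> converge to
\<open>C x\<close>, and the inverse matrix undoes this.\<close>

lemma rescaled_moments_limit:
  assumes i: "i \<in> {1..k}"
  shows "(\<lambda>n. rescaled_moments k n (dyck_moment (\<lambda>l. 1 + x l / sqrt (real n))) i) \<longlonglongrightarrow> x i"
proof -
  let ?B = "matrix_inverse k C_matrix"
  have lim: "(\<lambda>n. sqrt (real n) * (dyck_moment (\<lambda>l. 1 + x l / sqrt (real n)) j - catalan j))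
      \<longlonglongrightarrow> (\<Sum>l=1..k. C_matrix j l * x l)" if j: "j \<in> {1..k}" for j
  proof -
    let ?f = "\<lambda>e. dyck_moment (\<lambda>l. 1 + e * x l) j"
    have "((\<lambda>e. (?f e - ?f 0) / (e - 0)) \<longlongrightarrow> (\<Sum>l=1..k. C_matrix j l * x l)) (at 0)"
      using dyck_moment_has_derivative[of j k x] j unfolding has_field_derivative_iff by simp
    moreover have "filterlim (\<lambda>n. 1 / sqrt (real n)) (at 0) sequentially"
      unfolding filterlim_at by (auto intro!: eventually_sequentiallyI[of 1]) real_asymp
    ultimately have "(\<lambda>n. (?f (1 / sqrt (real n)) - ?f 0) / (1 / sqrt (real n) - 0))
        \<longlonglongrightarrow> (\<Sum>l=1..k. C_matrix j l * x l)"
      by (rule filterlim_compose)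
    moreover have "?f 0 = catalan j" using j by (simp add: dyck_moment_at_1)
    ultimately show ?thesis by (simp add: mult.commute)
  qed
  have "(\<lambda>n. \<Sum>j=1..k. ?B i j * (sqrt (real n) * (dyck_moment (\<lambda>l. 1 + x l / sqrt (real n)) j - catalan j)))
      \<longlonglongrightarrow> (\<Sum>j=1..k. ?B i j * (\<Sum>l=1..k. C_matrix j l * x l))"
    by (intro tendsto_sum tendsto_mult_left lim)
  also have "(\<Sum>j=1..k. ?B i j * (\<Sum>l=1..k. C_matrix j l * x l))
      = (\<Sum>l=1..k. (\<Sum>j=1..k. ?B i j * C_matrix j l) * x l)"
    unfolding sum_distrib_left sum_distrib_right by (subst sum.swap) (simp add: mult.assoc)
  also have "\<dots> = (\<Sum>l=1..k. if i = l then x l else 0)"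
    by (intro sum.cong refl) (subst C_matrix_inverse[OF i], auto)
  also have "\<dots> = x i" using i by simp
  finally show ?thesis
    using i by (simp add: rescaled_moments_def mat_vec_def sum_distrib_left mult_ac)
qed

text \<open>The first \<open>k\<close> moments depend only on the first \<open>k\<close> coordinates, so the remaining ones can be
integrated out before each coordinate is standardised.\<close>

lemma rescaled_moments_law:
  assumes \<gamma>: "\<And>j. j \<ge> 1 \<Longrightarrow> \<gamma> j > -1" and \<Omega>: "prob_space \<Omega>"
    and X: "distributed \<Omega> (Rn_lebesgue n) X (\<lambda>m. ennreal (moment_density \<gamma> (\<lambda>_. real n) n m))"
    and k: "1 \<le> k" "k \<le> n"
  shows "distr \<Omega> (Rn_borel k) (\<lambda>\<omega>. rescaled_moments k n (X \<omega>))
    = distr (Pi\<^sub>M {1..k} (\<lambda>j. density lborel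
          (\<lambda>x. ennreal (gamma_constant (\<gamma> j - real j) n * scaled_gamma (\<gamma> j - real j) n x))))
        (Rn_borel k) (\<lambda>x. rescaled_moments k n (dyck_moment (\<lambda>l. 1 + x l / sqrt (real n))))"
proof -
  define c where "c j = \<gamma> j - real j" for j
  define M where "M j = density lborel (\<lambda>z. ennreal (gamma_density (real n + c j + 1) (real n) z))" for j
  define D where "D j = density lborel (\<lambda>x. ennreal (gamma_constant (c j) n * scaled_gamma (c j) n x))" for j
  let ?h = "\<lambda>x::real. 1 + x / sqrt (real n)"
  have n: "n \<ge> 1" using k by simp
  have MD: "M j = distr (D j) borel ?h" for j
    unfolding M_def D_def by (rule gamma_density_as_distr[OF n])
  have probM: "prob_space (M j)" if "j \<in> {1..n}" for j
    unfolding M_def using \<gamma>[of j] that by (intro prob_space_gamma_density) (auto simp: c_def)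
  have probD: "prob_space (D j)" if "j \<in> {1..n}" for j
    using probM[OF that] unfolding MD by (rule prob_space_distrD[rotated]) (simp add: D_def)
  have setsM: "sets (M j) = sets borel" and setsD: "sets (D j) = sets borel" for j
    by (simp_all add: M_def D_def)
  have compM: "(\<lambda>x. x j) \<in> borel_measurable (Pi\<^sub>M I M)" if "j \<in> I" for j I
    using measurable_component_singleton[OF that, of M] measurable_cong_sets[OF refl setsM] by blast
  have law: "distr \<Omega> (Rn_borel n) X = distr (Pi\<^sub>M {1..n} M) (Rn_borel n) (dyck_moments n)"
  proof -
    have shape: "real n + c j + 1 = \<gamma> j + real n - real j + 1" for j by (simp add: c_def)
    show ?thesis
      unfolding M_def shape by (rule random_moments_law[OF \<gamma> _ \<Omega> X]) (use n in simp_all)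
  qed
  have Xm: "X \<in> measurable \<Omega> (Rn_borel n)"
  proof -
    have "sets (Rn_borel n) = sets (Rn_lebesgue n)" by (intro sets_PiM_cong) auto
    then show ?thesis using distributed_measurable[OF X] measurable_cong_sets[OF refl] by blast
  qed
  have \<Phi>: "rescaled_moments k n \<in> measurable (Rn_borel n) (Rn_borel k)"
    by (rule measurable_rescaled_moments) (use k in \<open>auto intro!: measurable_component_singleton\<close>)
  have dm: "dyck_moments n \<in> measurable (Pi\<^sub>M {1..n} M) (Rn_borel n)"
    by (rule measurable_dyck_moments) (rule setsM)
  have restr: "(\<lambda>z. restrict z {1..k}) \<in> measurable (Pi\<^sub>M {1..n} M) (Pi\<^sub>M {1..k} M)"
    using k by (intro measurable_restrict_subset) auto
  have \<Psi>: "(\<lambda>w. rescaled_moments k n (dyck_moment w)) \<in> measurable (Pi\<^sub>M {1..k} N) (Rn_borel k)"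
    if "\<And>j. sets (N j) = sets borel" for N :: "nat \<Rightarrow> real measure"
  proof (intro measurable_rescaled_moments measurable_dyck_moment)
    show "(\<lambda>w. w i) \<in> borel_measurable (Pi\<^sub>M {1..k} N)" if i: "i \<in> {1..k}" for i
      using measurable_component_singleton[OF i, of N] measurable_cong_sets[OF refl \<open>\<And>j. sets (N j) = sets borel\<close>] by blast
  qed auto
  have hM: "?h \<in> measurable (D j) (M j)" for j
    unfolding measurable_cong_sets[OF setsD setsM] by measurable
  have compose: "compose {1..k} ?h \<in> measurable (Pi\<^sub>M {1..k} D) (Pi\<^sub>M {1..k} M)"
    unfolding compose_def
  proof (rule measurable_restrict)
    fix i assume i: "i \<in> {1..k}"
    show "(\<lambda>x. ?h (x i)) \<in> measurable (Pi\<^sub>M {1..k} D) (M i)"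
      by (rule measurable_compose[where g = ?h, OF _ hM[of i]]) (rule measurable_component_singleton[OF i])
  qed
  have PM: "distr (Pi\<^sub>M {1..k} D) (Pi\<^sub>M {1..k} M) (compose {1..k} ?h) = Pi\<^sub>M {1..k} M"
  proof -
    have "distr (D j) (M j) ?h = M j" for j
    proof -
      have "distr (D j) (M j) ?h = distr (D j) borel ?h" by (rule distr_cong) (simp_all add: setsM)
      then show ?thesis unfolding MD .
    qed
    then show ?thesis
      using k by (subst distr_PiM_finite_prob_space'[OF _ probD probM hM]) auto
  qed
  have "distr \<Omega> (Rn_borel k) (\<lambda>\<omega>. rescaled_moments k n (X \<omega>))
      = distr (distr \<Omega> (Rn_borel n) X) (Rn_borel k) (rescaled_moments k n)"
    by (subst distr_distr[OF \<Phi> Xm]) (simp add: o_def)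
  also have "\<dots> = distr (Pi\<^sub>M {1..n} M) (Rn_borel k) (\<lambda>z. rescaled_moments k n (dyck_moments n z))"
    unfolding law by (subst distr_distr[OF \<Phi> dm]) (simp add: o_def)
  also have "\<dots> = distr (Pi\<^sub>M {1..n} M) (Rn_borel k) (\<lambda>z. rescaled_moments k n (dyck_moment (restrict z {1..k})))"
    using k by (intro arg_cong[where f = "distr _ _"] ext rescaled_moments_cong)
      (auto simp: dyck_moments_def intro!: dyck_moment_cong)
  also have "\<dots> = distr (distr (Pi\<^sub>M {1..n} M) (Pi\<^sub>M {1..k} M) (\<lambda>z. restrict z {1..k})) (Rn_borel k)
      (\<lambda>w. rescaled_moments k n (dyck_moment w))"
    by (subst distr_distr[OF \<Psi> restr]) (simp_all add: o_def setsM)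
  also have "\<dots> = distr (Pi\<^sub>M {1..k} M) (Rn_borel k) (\<lambda>w. rescaled_moments k n (dyck_moment w))"
    using k probM by (subst distr_PiM_restrict) auto
  also have "\<dots> = distr (distr (Pi\<^sub>M {1..k} D) (Pi\<^sub>M {1..k} M) (compose {1..k} ?h)) (Rn_borel k)
      (\<lambda>w. rescaled_moments k n (dyck_moment w))"
    by (simp only: PM)
  also have "\<dots> = distr (Pi\<^sub>M {1..k} D) (Rn_borel k) (\<lambda>x. rescaled_moments k n (dyck_moment (compose {1..k} ?h x)))"
    by (subst distr_distr[OF \<Psi> compose]) (simp_all add: o_def setsM)
  also have "\<dots> = distr (Pi\<^sub>M {1..k} D) (Rn_borel k) (\<lambda>x. rescaled_moments k n (dyck_moment (\<lambda>l. ?h (x l))))"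
    by (intro arg_cong[where f = "distr _ _"] ext rescaled_moments_cong)
      (auto simp: compose_def intro!: dyck_moment_cong)
  finally show ?thesis unfolding D_def c_def .
qed

theorem theorem3p4:
  fixes \<gamma> :: "nat \<Rightarrow> real"
    and \<Omega> :: "nat \<Rightarrow> 'a measure"
    and X :: "nat \<Rightarrow> 'a \<Rightarrow> (nat \<Rightarrow> real)"
    and k :: nat
  assumes "\<And>j. j \<ge> 1 \<Longrightarrow> \<gamma> j > -1"
    and "\<And>n. n \<ge> 1 \<Longrightarrow> prob_space (\<Omega> n)"
    and "\<And>n. n \<ge> 1 \<Longrightarrow>
           distributed (\<Omega> n) (Rn_lebesgue n) (X n)
             (\<lambda>m. ennreal (moment_density \<gamma> (\<lambda>_. real n) n m))"
    and "k \<ge> 1"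
  shows "(\<forall>j\<in>{1..k}. moment marchenko_pastur j = catalan j) \<and>
         weak_convergence (Rn_topology k)
           (\<lambda>n. distr (\<Omega> n) (Rn_borel k)
              (\<lambda>\<omega>. \<lambda>i\<in>{1..k}. sqrt (real n) *
                 mat_vec k (matrix_inverse k C_matrix) (\<lambda>j. X n \<omega> j - catalan j) i))
           (std_normal_Rn k)"
proof (intro conjI ballI)
  show "moment marchenko_pastur j = catalan j" for j by (rule moment_marchenko_pastur)
  show "weak_convergence (Rn_topology k)
           (\<lambda>n. distr (\<Omega> n) (Rn_borel k)
              (\<lambda>\<omega>. \<lambda>i\<in>{1..k}. sqrt (real n) *
                 mat_vec k (matrix_inverse k C_matrix) (\<lambda>j. X n \<omega> j - catalan j) i))
           (std_normal_Rn k)"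
    unfolding weak_convergence_def rescaled_moments_def[symmetric]
  proof (intro allI impI, elim conjE)
    fix f assume f: "continuous_map (Rn_topology k) euclideanreal f"
      and bdd: "bounded (f ` topspace (Rn_topology k))"
    define c where "c j = \<gamma> j - real j" for j
    define T where "T n x = rescaled_moments k n (dyck_moment (\<lambda>l. 1 + x l / sqrt (real n)))" for n and x :: "nat \<Rightarrow> real"
    define D where "D n = Pi\<^sub>M {1..k} (\<lambda>j. density lborel
          (\<lambda>x. ennreal (gamma_constant (c j) n * scaled_gamma (c j) n x)))" for n
    obtain B where B: "\<And>y. y \<in> topspace (Rn_topology k) \<Longrightarrow> \<bar>f y\<bar> \<le> B"
      using bdd unfolding bounded_iff by auto
    have fm: "f \<in> borel_measurable (Rn_borel k)"
      by (rule borel_measurable_continuous_map_Rn[OF f])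
    have sets: "sets (Rn_lebesgue k) = sets (Rn_borel k)" by (intro sets_PiM_cong) auto
    have T_top: "T n x \<in> topspace (Rn_topology k)" for n x
      by (auto simp: T_def rescaled_moments_def)
    have Tm: "T n \<in> measurable (Rn_lebesgue k) (Rn_borel k)" for n
      unfolding T_def
    proof (intro measurable_rescaled_moments measurable_dyck_moment)
      show "(\<lambda>x. 1 + x i / sqrt (real n)) \<in> borel_measurable (Rn_lebesgue k)" if "i \<in> {1..k}" for i
        using measurable_Rn_lebesgue_component[OF that] by (intro borel_measurable_add borel_measurable_divide) auto
    qed auto
    have "(\<lambda>n. \<integral>x. f (T n x) \<partial>D n) \<longlonglongrightarrow> (\<integral>x. f x \<partial>std_normal_Rn k)"
      unfolding D_def
    proof (rule gamma_product_clt)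
      show "(\<lambda>x. f (T n x)) \<in> borel_measurable (Rn_lebesgue k)" for n
        by (rule measurable_compose[OF Tm fm])
      show "f \<in> borel_measurable (Rn_lebesgue k)"
        using fm measurable_cong_sets[OF sets refl] by blast
      show "\<bar>f (T n x)\<bar> \<le> B" for n x by (rule B[OF T_top])
      show "real n + c j + 1 > 0" if "n \<ge> k" "j \<in> {1..k}" for n j
        using assms(1)[of j] that by (auto simp: c_def)
      fix x assume x: "x \<in> space (Rn_lebesgue k)"
      have "limitin (Rn_topology k) (\<lambda>n. T n x) x sequentially"
        unfolding limitin_componentwise
        using x rescaled_moments_limit[of _ k x] T_top by (auto simp: T_def space_PiM PiE_def)
      then show "(\<lambda>n. f (T n x)) \<longlonglongrightarrow> f x"
        using continuous_map_limit[OF f] by (auto simp: o_def)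
    qed
    moreover have "(\<integral>x. f (T n x) \<partial>D n) = (\<integral>y. f y \<partial>distr (\<Omega> n) (Rn_borel k) (\<lambda>\<omega>. rescaled_moments k n (X n \<omega>)))"
      if "n \<ge> k" for n
    proof -
      have "T n \<in> measurable (D n) (Rn_borel k)"
        using Tm measurable_cong_sets[of "D n" "Rn_lebesgue k"] by (auto simp: D_def cong: sets_PiM_cong)
      moreover have "distr (\<Omega> n) (Rn_borel k) (\<lambda>\<omega>. rescaled_moments k n (X n \<omega>)) = distr (D n) (Rn_borel k) (T n)"
        unfolding D_def T_def[abs_def] c_def
        by (rule rescaled_moments_law[OF assms(1) assms(2) assms(3)]) (use assms(4) that in auto)
      ultimately show ?thesis
        using fm by (simp only: integral_distr)
    qed
    then have "eventually (\<lambda>n. (\<integral>x. f (T n x) \<partial>D n)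
        = (\<integral>y. f y \<partial>distr (\<Omega> n) (Rn_borel k) (\<lambda>\<omega>. rescaled_moments k n (X n \<omega>)))) sequentially"
      unfolding eventually_sequentially by blast
    ultimately show "(\<lambda>n. \<integral>y. f y \<partial>distr (\<Omega> n) (Rn_borel k) (\<lambda>\<omega>. rescaled_moments k n (X n \<omega>)))
        \<longlonglongrightarrow> (\<integral>x. f x \<partial>std_normal_Rn k)"
      by (rule Lim_transform_eventually)
  qed
qed

end
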